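(* Let $q$ be a prime power and let $t$, $k_1,\ldots,k_t,n_1,\ldots,n_t$ be positive integers such that $k_i<n_i$ for each $i\in\{1,\ldots,t\}$. Then the direct sum $$\mathcal U_{k_1,n_1}(q)\oplus\cdots\oplus\mathcal U_{k_t,n_t}(q)$$ is representable. In particular, it is representable over every field $\mathbb F_{q^m}$ such that $m=m_1\cdots m_t$ for any positive integers $m_1,\ldots,m_t$ satisfying $\gcd(m_i,m_j)=1$ for each $i\ne j$ and $m_i\ge n_i$ for each $i\in\{1,\ldots,t\}$.
   Context: For a finite-dimensional $\mathbb F_q$-vector space $E$ let $\mathcal L(E)$ be the lattice of its subspaces. A $q$-matroid with ground space $E$ is a pair $(E,\rho)$ with $\rho:\mathcal L(E)\to\mathbb Z$ satisfying, for all $A,B\in\mathcal L(E)$: $0\le\rho(A)\le\dim A$; $A\le B\Rightarrow\rho(A)\le\rho(B)$; $\rho(A+B)+\rho(A\cap B)\le\rho(A)+\rho(B)$. Its rank is $\rho(E)$. The uniform $q$-matroid $\mathcal U_{k,n}(q)$ is $(\mathbb F_q^n,\rho)$ with $\rho(V)=\min\{k,\dim V\}$. **Direct sum.** For $q$-matroids $\mathcal M_i=(E_i,\rho_i)$, $i=1,2$, let $E=E_1\oplus E_2$ with projections $\pi_i:E\to E_i$ and $\rho_i'(V)=\rho_i(\pi_i(V))$. Then $\mathcal M_1\oplus\mathcal M_2=(E,\rho)$ with $\rho(V)=\dim V+\min_{X\le V}(\rho_1'(X)+\rho_2'(X)-\dim X)$. For $t>2$, $\mathcal M_1\oplus\cdots\oplus\mathcal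 M_t:=(\mathcal M_1\oplus\cdots\oplus\mathcal M_{t-1})\oplus\mathcal M_t$. Here $\mathbb F_q^{n_1}\oplus\cdots\oplus\mathbb F_q^{n_t}$ is identified with $\mathbb F_q^{n_1+\ldots+n_t}$. **Representability.** For a matrix $G$ with $n$ columns and entries in $\mathbb F_{q^m}$, $\mathcal M_G=(\mathbb F_q^n,\rho)$ is the $q$-matroid with $\rho(U)=\mathrm{rk}(GA^U)$, where $A^U$ is a matrix whose columns form a basis of $U\le\mathbb F_q^n$. A $q$-matroid $\mathcal M$ with ground space $\mathbb F_q^n$ is $\mathbb F_{q^m}$-representable (representable over $\mathbb F_{q^m}$) if $\mathcal M=\mathcal M_G$ for some such matrix $G$ whose rank equals the rank of $\mathcal M$; it is representable if it is $\mathbb F_{q^m}$-representable for some field extension $\mathbb F_{q^m}$ of $\mathbb F_q$. *)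

theory Defs
  imports
    "Jordan_Normal_Form.DL_Rank"
    "Jordan_Normal_Form.Ring_Hom_Matrix"
    "HOL-Algebra.Algebraic_Closure_Type"
    "HOL-Library.FuncSet"
    "HOL-Library.Cardinality"
begin

text \<open>The field with \<open>q\<close> elements is an arbitrary type \<open>'a\<close> of sort \<open>{finite, field}\<close>, with
  \<open>q = CARD('a)\<close>; its space of \<open>n\<close>-dimensional vectors is \<open>carrier_vec n\<close>.\<close>

definition subspaces :: "nat \<Rightarrow> 'a::field vec set set" where
  "subspaces n = {V. VectorSpace.subspace class_ring V (module_vec TYPE('a) n)}"

definition vdim :: "nat \<Rightarrow> 'a::field vec set \<Rightarrow> nat" where
  "vdim n V = vectorspace.dim class_ring ((module_vec TYPE('a) n)\<lparr>carrier := V\<rparr>)"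

definition is_basis_mat :: "nat \<Rightarrow> 'a::field vec set \<Rightarrow> 'a mat \<Rightarrow> bool" where
  "is_basis_mat n U A \<longleftrightarrow> dim_row A = n \<and> distinct (cols A) \<and>
     vectorspace.basis class_ring ((module_vec TYPE('a) n)\<lparr>carrier := U\<rparr>) (set (cols A))"

definition basis_mat :: "nat \<Rightarrow> 'a::field vec set \<Rightarrow> 'a mat" where
  "basis_mat n U = (SOME A. is_basis_mat n U A)"

text \<open>A pair of the dimension \<open>n\<close> of the ground space and the rank function. Rank functions are
  made extensional on the lattice of subspaces, so that equality of the pairs is equality of the
  \<open>q\<close>-matroids.\<close>

datatype 'a qmatroid = QMatroid (ground_dim: nat) (rank_fun: "'a vec set \<Rightarrow> int")

definition q_matroid :: "'a::{finite,field} qmatroid \<Rightarrow> bool" where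
  "q_matroid M \<longleftrightarrow> (let n = ground_dim M; \<rho> = rank_fun M in
     \<rho> \<in> extensional (subspaces n) \<and>
     (\<forall>A\<in>subspaces n. 0 \<le> \<rho> A \<and> \<rho> A \<le> int (vdim n A)) \<and>
     (\<forall>A\<in>subspaces n. \<forall>B\<in>subspaces n. A \<subseteq> B \<longrightarrow> \<rho> A \<le> \<rho> B) \<and>
     (\<forall>A\<in>subspaces n. \<forall>B\<in>subspaces n.
        \<rho> {a + b |a b. a \<in> A \<and> b \<in> B} + \<rho> (A \<inter> B) \<le> \<rho> A + \<rho> B))"

definition qm_rank :: "'a::{finite,field} qmatroid \<Rightarrow> int" where
  "qm_rank M = rank_fun M (carrier_vec (ground_dim M))"

definition uniform_qm :: "nat \<Rightarrow> nat \<Rightarrow> 'a::{finite,field} qmatroid" where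
  "uniform_qm k n = QMatroid n (\<lambda>V\<in>subspaces n. int (min k (vdim n V)))"

text \<open>The direct sum of the ground spaces is identified with \<open>carrier_vec (n1 + n2)\<close> by
  concatenation, so that the projections take the first \<open>n1\<close> and the last \<open>n2\<close> coordinates.\<close>

definition direct_sum ::
  "'a::{finite,field} qmatroid \<Rightarrow> 'a qmatroid \<Rightarrow> 'a qmatroid" where
  "direct_sum M1 M2 = (let n1 = ground_dim M1; n2 = ground_dim M2; n = n1 + n2 in
     QMatroid n (\<lambda>V\<in>subspaces n. int (vdim n V) +
       (MIN W\<in>{W \<in> subspaces n. W \<subseteq> V}.
          rank_fun M1 ((\<lambda>v. vec_first v n1) ` W) + rank_fun M2 ((\<lambda>v. vec_last v n2) ` W)
            - int (vdim n W))))"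

text \<open>\<open>((M 1 \<oplus> M 2) \<oplus> \<dots>) \<oplus> M t\<close>, for \<open>t \<ge> 1\<close>.\<close>

definition direct_sums :: "(nat \<Rightarrow> 'a::{finite,field} qmatroid) \<Rightarrow> nat \<Rightarrow> 'a qmatroid" where
  "direct_sums M t = foldl direct_sum (M 1) (map M [2..<Suc t])"

text \<open>\<open>K\<close>, a subfield of the field \<open>'b\<close>, is an extension of degree \<open>m\<close> of \<open>'a\<close>
  via the embedding \<open>h\<close>, i.e. \<open>K\<close> is a field with \<open>q ^ m\<close> elements.\<close>

definition extension_of_degree ::
  "('a::{finite,field} \<Rightarrow> 'b::field) \<Rightarrow> 'b set \<Rightarrow> nat \<Rightarrow> bool" where
  "extension_of_degree h K m \<longleftrightarrow>
     field_hom h \<and> subfield K class_ring \<and> range h \<subseteq> K \<and> card K = CARD('a) ^ m"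

text \<open>The \<open>q\<close>-matroid of a matrix \<open>G\<close>. The rank is computed over \<open>'b\<close>; the rank of a matrix does not
  depend on the field containing its entries, nor on the choice of the basis of \<open>U\<close>.\<close>

definition matrix_qm :: "('a::{finite,field} \<Rightarrow> 'b::field) \<Rightarrow> 'b mat \<Rightarrow> 'a qmatroid" where
  "matrix_qm h G = QMatroid (dim_col G) (\<lambda>U\<in>subspaces (dim_col G).
     int (vec_space.rank (dim_row G) (G * map_mat h (basis_mat (dim_col G) U))))"

definition representable_over ::
  "('a::{finite,field} \<Rightarrow> 'b::field) \<Rightarrow> 'b set \<Rightarrow> 'a qmatroid \<Rightarrow> bool" where
  "representable_over h K M \<longleftrightarrow> q_matroid M \<and>
     (\<exists>G. dim_col G = ground_dim M \<and> elements_mat G \<subseteq> K \<and>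
          int (vec_space.rank (dim_row G) G) = qm_rank M \<and> M = matrix_qm h G)"

text \<open>An existential quantifier cannot range over types; every finite extension of \<open>'a\<close> is
  isomorphic over \<open>'a\<close> to a subfield of the algebraic closure of \<open>'a\<close>.\<close>

definition representable :: "'a::{finite,field} qmatroid \<Rightarrow> bool" where
  "representable M \<longleftrightarrow>
     (\<exists>m>0. \<exists>K. extension_of_degree to_ac K m \<and> representable_over to_ac K M)"

end

theory Submission
  imports
    Defs
    "HOL-Library.Function_Algebras"
    "HOL-Algebra.Sylow"
begin

text \<open>
  Let \<open>q = CARD('a)\<close>. For a subspace \<open>V\<close> of the ground space and a set \<open>T\<close> of coordinates, write \<open>d T\<close>
  for the dimension of the projection of \<open>V\<close> to the coordinates in \<open>T\<close>. If \<open>B 1, \<dots>, B t\<close> are the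
  blocks of coordinates, the rank of \<open>V\<close> in the direct sum of the uniform \<open>q\<close>-matroids of ranks \<open>k i\<close>
  is the minimum, over all \<open>S \<subseteq> {1..t}\<close>, of \<open>(\<Sum>i\<in>S. k i) + d (\<Union>i\<in>{1..t} - S. B i)\<close>. This follows by
  induction on \<open>t\<close> from the definition of the direct sum, the minimum over subspaces being attained
  at kernels of projections (\<open>rank_direct_sum_uniform\<close>, \<open>direct_sums_uniform\<close>).

  The representing matrix \<open>G\<close> is block diagonal. A field of order \<open>q ^ (m 1 * \<dots> * m t)\<close> has
  subfields \<open>F 1 \<subseteq> \<dots> \<subseteq> F (t + 1)\<close> where \<open>F 1\<close> has order \<open>q\<close> and \<open>F (i + 1)\<close> has degree \<open>m i\<close> over
  \<open>F i\<close>. Block \<open>i\<close> is a Moore matrix: choose elements \<open>\<alpha> j\<close> of \<open>F (i + 1)\<close>, for \<open>j \<in> B i\<close>, that are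
  linearly independent over \<open>F i\<close>, which is possible as \<open>n i \<le> m i\<close>, and let the \<open>k i\<close> rows be the
  images of the row \<open>\<alpha>\<close> under the powers of the Frobenius map \<open>\<sigma>\<close> whose fixed field is \<open>F i\<close>.

  The rank of the matroid of \<open>G\<close> at \<open>V\<close> is the dimension of the space spanned by the rows of \<open>G\<close>, seen
  as functions on \<open>V\<close>. The rows of the last block are the conjugates \<open>w, \<sigma> w, \<sigma>\<^sup>2 w, \<dots>\<close> of one
  function \<open>w = (\<Sum>j\<in>B t. \<alpha> j * c j)\<close>, where the \<open>c j\<close> are the coordinate functions, and the
  preceding rows and all the \<open>c j\<close> are fixed by \<open>\<sigma>\<close>. If each of the \<open>k t\<close> conjugates is independent
  of what comes before, the last block contributes \<open>k t\<close>. Otherwise the span becomes stable under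
  \<open>\<sigma>\<close> at some stage, and a stable subspace that contains \<open>w\<close> contains all \<open>c j\<close> with \<open>j \<in> B t\<close>, by
  Galois descent (\<open>fixed_functions_in_stable_subspace\<close>, \<open>dim_with_conjugates\<close>). Hence the dimension is
  the smaller of two numbers of the same kind with one block less, where in the second the
  coordinates of the last block have become additional generators. This is the recursion that the
  minimum over all \<open>S\<close> satisfies as well (\<open>block_rank\<close>, \<open>dim_block_rows\<close>), so \<open>G\<close> represents the direct
  sum.

  For representability over some finite field, the choice \<open>m i = n i\<close> and the field of order
  \<open>q ^ (n 1 * \<dots> * n t)\<close> in the algebraic closure suffice.
\<close>

section \<open>Dimension in vector spaces\<close>

context vector_space
begin

text \<open>The vector spaces of functions below are infinite-dimensional, so the usual facts on dimensions
  are proved for finite generating sets instead of finite-dimensional spaces.\<close>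

lemma dim_mono_finite:
  assumes "V \<subseteq> span W" "finite W"
  shows "dim V \<le> dim W"
proof -
  obtain B where B: "B \<subseteq> W" "independent B" "W \<subseteq> span B" "card B = dim W"
    using basis_exists .
  have "V \<subseteq> span B"
    using assms(1) B(3) span_minimal[OF B(3) subspace_span] by blast
  with B assms(2) show ?thesis
    by (metis dim_le_card finite_subset)
qed

lemma dim_subset_finite: "V \<subseteq> W \<Longrightarrow> finite W \<Longrightarrow> dim V \<le> dim W"
  by (meson dim_mono_finite span_superset subset_trans)

lemma dim_insert_notin_span:
  assumes "finite S" "x \<notin> span S"
  shows "dim (insert x S) = Suc (dim S)"
proof -
  obtain B where B: "B \<subseteq> S" "independent B" "S \<subseteq> span B" "card B = dim S"
    using basis_exists .
  have fin: "finite B" using B(1) assms(1) finite_subset by blast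
  have x: "x \<notin> span B" using assms(2) B(1) span_mono by blast
  have "dim (insert x S) = card (insert x B)"
  proof (rule dim_unique[OF _ _ independent_insertI[OF x B(2)] refl])
    show "insert x B \<subseteq> insert x S" using B(1) by blast
    show "insert x S \<subseteq> span (insert x B)"
      using B(3) by (metis insert_subset insertI1 span_base span_mono subset_insertI subset_trans)
  qed
  also have "\<dots> = Suc (dim S)" using x fin B(4) span_base by (metis card_insert_disjoint)
  finally show ?thesis .
qed

text \<open>Extend a basis of \<open>Z\<close> to a basis of the span of \<open>U\<close>: the new elements, together
  with a basis of the span of \<open>Y\<close>, which contains \<open>Z\<close>, generate \<open>U \<union> Y\<close>.\<close>

lemma dim_submodular:
  assumes "finite U" "finite Y" "Z \<subseteq> span U \<inter> span Y"
  shows "dim (U \<union> Y) + dim Z \<le> dim U + dim Y"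
proof -
  obtain D where D: "D \<subseteq> Z" "independent D" "Z \<subseteq> span D" "card D = dim Z"
    using basis_exists .
  have "D \<subseteq> span U" using D(1) assms(3) by blast
  then obtain B where B: "D \<subseteq> B" "B \<subseteq> span U" "independent B" "span U \<subseteq> span B"
    using maximal_independent_subset_extend[OF _ D(2), of "span U"] by blast
  have cB: "card B = dim U"
    using basis_card_eq_dim[OF B(2,4,3)] by simp
  have finB: "finite B"
    using independent_span_bound[OF assms(1) B(3,2)] by blast
  obtain C where C: "C \<subseteq> Y" "independent C" "Y \<subseteq> span C" "card C = dim Y"
    using basis_exists .
  have finC: "finite C" using C(1) assms(2) finite_subset by blast
  have "D \<subseteq> span C"
    using D(1) assms(3) span_minimal[OF C(3) subspace_span] by blast
  then have "B \<subseteq> span (C \<union> (B - D))"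
    using span_mono[of C "C \<union> (B - D)"] span_superset[of "C \<union> (B - D)"] by blast
  then have "span B \<subseteq> span (C \<union> (B - D))" by (rule span_minimal[OF _ subspace_span])
  then have "U \<union> Y \<subseteq> span (C \<union> (B - D))"
    using B(4) span_superset[of U] C(3) span_mono[of C "C \<union> (B - D)"] by blast
  then have "dim (U \<union> Y) \<le> card (C \<union> (B - D))"
    using finB finC by (intro dim_le_card) auto
  also have "\<dots> \<le> card C + card (B - D)" by (rule card_Un_le)
  also have "\<dots> = card C + (card B - card D)"
    using B(1) finB by (simp add: card_Diff_subset finite_subset)
  finally show ?thesis
    using card_mono[OF finB B(1)] cB C(4) D(4) by linarith
qed

lemma dim_Un_le: "finite U \<Longrightarrow> finite Y \<Longrightarrow> dim (U \<union> Y) \<le> dim U + dim Y"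
  using dim_submodular[of U Y "{}"] by simp

end

context vector_space_pair
begin

lemma dim_image_le_finite:
  assumes "Vector_Spaces.linear s1 s2 f" "finite V"
  shows "vs2.dim (f ` V) \<le> vs1.dim V"
proof -
  obtain B where B: "B \<subseteq> V" "vs1.independent B" "V \<subseteq> vs1.span B" "card B = vs1.dim V"
    using vs1.basis_exists .
  have fin: "finite B" using B(1) assms(2) finite_subset by blast
  have "f ` V \<subseteq> vs2.span (f ` B)"
    using B(3) linear_span_image[OF assms(1), of B] by blast
  then have "vs2.dim (f ` V) \<le> card (f ` B)" using fin by (intro vs2.dim_le_card) auto
  with card_image_le[OF fin, of f] B(4) show ?thesis by linarith
qed

text \<open>The dimension of \<open>V\<close> modulo \<open>U\<close> cannot grow under a linear map.\<close>

lemma dim_image_diff_mono: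
  assumes "Vector_Spaces.linear s1 s2 f" "finite V" "U \<subseteq> V"
  shows "vs2.dim (f ` V) + vs1.dim U \<le> vs2.dim (f ` U) + vs1.dim V"
proof -
  obtain D where D: "D \<subseteq> U" "vs1.independent D" "U \<subseteq> vs1.span D" "card D = vs1.dim U"
    using vs1.basis_exists .
  have "D \<subseteq> V" using D(1) assms(3) by blast
  then obtain B where B: "D \<subseteq> B" "B \<subseteq> V" "vs1.independent B" "V \<subseteq> vs1.span B"
    using vs1.maximal_independent_subset_extend[OF _ D(2), of V] by blast
  have cB: "card B = vs1.dim V" using vs1.basis_card_eq_dim[OF B(2,4,3)] .
  have fin: "finite B" using B(2) assms(2) finite_subset by blast
  have finU: "finite U" using assms(2,3) finite_subset by blast
  have "f ` V \<subseteq> vs2.span (f ` B)"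
    using B(4) linear_span_image[OF assms(1), of B] by blast
  also have "\<dots> \<subseteq> vs2.span (f ` U \<union> f ` (B - D))"
    using D(1) by (intro vs2.span_mono) blast
  finally have "vs2.dim (f ` V) \<le> vs2.dim (f ` U \<union> f ` (B - D))"
    using fin finU by (intro vs2.dim_mono_finite) auto
  also have "\<dots> \<le> vs2.dim (f ` U) + vs2.dim (f ` (B - D))"
    using fin finU by (intro vs2.dim_Un_le) auto
  also have "vs2.dim (f ` (B - D)) \<le> card (f ` (B - D))"
    using fin by (intro vs2.dim_le_card') auto
  also have "\<dots> \<le> card (B - D)" using fin by (intro card_image_le) auto
  also have "\<dots> = card B - card D"
    using B(1) fin by (simp add: card_Diff_subset finite_subset)
  finally show ?thesis using card_mono[OF fin B(1)] cB D(4) by linarith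
qed

text \<open>One half of the rank-nullity theorem: preimages of a basis of the image generate \<open>V\<close>
  modulo the kernel.\<close>

lemma dim_le_kernel_plus_image:
  assumes f: "Vector_Spaces.linear s1 s2 f" and fin: "finite V" and V: "vs1.subspace V"
  shows "vs1.dim V \<le> vs1.dim {v \<in> V. f v = 0} + vs2.dim (f ` V)"
proof -
  obtain D where D: "D \<subseteq> f ` V" "vs2.independent D" "f ` V \<subseteq> vs2.span D" "card D = vs2.dim (f ` V)"
    using vs2.basis_exists .
  obtain D' where D': "D' \<subseteq> V" "inj_on f D'" "f ` D' = D"
    using D(1) unfolding subset_image_inj by metis
  let ?U = "{v \<in> V. f v = 0}"
  have finD': "finite D'" using D'(1) fin finite_subset by blast
  have "V \<subseteq> vs1.span (?U \<union> D')"
  proof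
    fix v assume v: "v \<in> V"
    then have "f v \<in> f ` vs1.span D'"
      using D(3) D'(3) linear_span_image[OF f, of D'] by blast
    then obtain u where u: "u \<in> vs1.span D'" "f v = f u" by blast
    have "u \<in> V" using u(1) vs1.span_minimal[OF D'(1) V] by blast
    then have "v - u \<in> ?U"
      using v u(2) V linear_diff[OF f] by (simp add: vs1.subspace_diff)
    then have "v - u \<in> vs1.span (?U \<union> D')" by (simp add: vs1.span_base)
    moreover have "u \<in> vs1.span (?U \<union> D')" using u(1) vs1.span_mono[of D' "?U \<union> D'"] by blast
    ultimately show "v \<in> vs1.span (?U \<union> D')" using vs1.span_add by fastforce
  qed
  then have "vs1.dim V \<le> vs1.dim (?U \<union> D')"
    using fin finD' by (intro vs1.dim_mono_finite) auto
  also have "\<dots> \<le> vs1.dim ?U + vs1.dim D'" using fin finD' by (intro vs1.dim_Un_le) auto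
  also have "vs1.dim D' \<le> card D'" using finD' by (intro vs1.dim_le_card') auto
  also have "card D' = card D" using card_image[OF D'(2)] D'(3) by simp
  finally show ?thesis using D(4) by simp
qed

end

section \<open>The vector space of functions\<close>

definition fscale :: "'b::field \<Rightarrow> ('x \<Rightarrow> 'b) \<Rightarrow> 'x \<Rightarrow> 'b" where
  "fscale c f = (\<lambda>x. c * f x)"

interpretation fvs: vector_space fscale
  by unfold_locales (auto simp: fscale_def fun_eq_iff algebra_simps)

interpretation fvp: vector_space_pair fscale fscale ..

lemma fun_sum_apply: "(\<Sum>a\<in>A. f a) x = (\<Sum>a\<in>A. f a x)"
  by (induction A rule: infinite_finite_induct) auto

lemma linear_fun_iff:
  "Vector_Spaces.linear fscale fscale f \<longleftrightarrow>
    (\<forall>x y. f (x + y) = f x + f y) \<and> (\<forall>c x. f (fscale c x) = fscale c (f x))"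
  by (simp add: Vector_Spaces.linear_iff fvs.vector_space_axioms)

lemma in_span_imageE:
  assumes "f \<in> fvs.span (g ` I)" "finite I"
  obtains c where "f = (\<lambda>x. \<Sum>i\<in>I. c i * g i x)"
proof -
  have "\<exists>c. f = (\<lambda>x. \<Sum>i\<in>I. c i * g i x)"
    using assms(1)
  proof (induction rule: fvs.span_induct_alt)
    case base
    show ?case by (rule exI[of _ "\<lambda>_. 0"]) (simp add: fun_eq_iff)
  next
    case (step c x y)
    then obtain i d where i: "i \<in> I" "x = g i" and d: "y = (\<lambda>x. \<Sum>i\<in>I. d i * g i x)" by blast
    have "fscale c x + y = (\<lambda>z. \<Sum>j\<in>I. (if j = i then c else 0) * g j z + d j * g j z)"
      using assms(2) i by (simp add: fun_eq_iff fscale_def d sum.distrib mult_delta_left sum.delta)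
    also have "\<dots> = (\<lambda>z. \<Sum>j\<in>I. ((if j = i then c else 0) + d j) * g j z)"
      by (simp only: distrib_right)
    finally have "fscale c x + y = \<dots>" .
    then show ?case by (rule exI[of _ "\<lambda>j. (if j = i then c else 0) + d j"])
  qed
  then show ?thesis using that by blast
qed

lemma sum_in_span:
  assumes "\<And>i. i \<in> I \<Longrightarrow> g i \<in> fvs.span S"
  shows "(\<lambda>x. \<Sum>i\<in>I. c i * g i x) \<in> fvs.span S"
proof -
  have "(\<lambda>x. \<Sum>i\<in>I. c i * g i x) = (\<Sum>i\<in>I. fscale (c i) (g i))"
    by (simp add: fun_eq_iff fun_sum_apply fscale_def)
  also have "\<dots> \<in> fvs.span S" using assms by (intro fvs.span_sum fvs.span_scale)
  finally show ?thesis .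
qed

text \<open>Writing every row as a combination of a basis of the row space factors the matrix through
  that basis; read the other way, every column is a combination of the coefficient vectors,
  of which there are as many as basis elements.\<close>

lemma dim_rows_ge_dim_columns:
  fixes M :: "'x \<Rightarrow> 'y \<Rightarrow> 'b::field"
  assumes "finite (range M)"
  shows "fvs.dim (range (\<lambda>y x. M x y)) \<le> fvs.dim (range M)"
proof -
  obtain B where B: "B \<subseteq> range M" "fvs.independent B" "range M \<subseteq> fvs.span B"
      "card B = fvs.dim (range M)"
    using fvs.basis_exists .
  have fin: "finite B" using B(1) assms finite_subset by blast
  have "\<forall>x. \<exists>c. M x = (\<lambda>y. \<Sum>b\<in>B. c b * b y)"
  proof
    fix x
    have "M x \<in> fvs.span ((\<lambda>b. b) ` B)" using B(3) by auto
    then show "\<exists>c. M x = (\<lambda>y. \<Sum>b\<in>B. c b * b y)" using fin by (rule in_span_imageE) blast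
  qed
  then obtain c where c: "\<And>x. M x = (\<lambda>y. \<Sum>b\<in>B. c x b * b y)" by metis
  have "range (\<lambda>y x. M x y) \<subseteq> fvs.span ((\<lambda>b x. c x b) ` B)"
  proof clarify
    fix y
    have "(\<lambda>x. M x y) = (\<lambda>x. \<Sum>b\<in>B. b y * c x b)"
      by (subst c) (simp add: mult.commute)
    also have "\<dots> \<in> fvs.span ((\<lambda>b x. c x b) ` B)" by (intro sum_in_span fvs.span_base) auto
    finally show "(\<lambda>x. M x y) \<in> fvs.span ((\<lambda>b x. c x b) ` B)" .
  qed
  then have "fvs.dim (range (\<lambda>y x. M x y)) \<le> card ((\<lambda>b x. c x b) ` B)"
    using fin by (intro fvs.dim_le_card) auto
  also have "\<dots> \<le> card B" using fin by (rule card_image_le)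
  finally show ?thesis using B(4) by simp
qed

lemma dim_rows_eq_dim_columns:
  fixes M :: "'x \<Rightarrow> 'y \<Rightarrow> 'b::field"
  assumes "finite (range M)" "finite (range (\<lambda>y x. M x y))"
  shows "fvs.dim (range M) = fvs.dim (range (\<lambda>y x. M x y))"
  using dim_rows_ge_dim_columns[OF assms(1)] dim_rows_ge_dim_columns[OF assms(2)] by simp

text \<open>The larger field is a vector space over the smaller one, in which the image of \<open>h\<close> has
  a linear complement.\<close>

lemma retraction_of_field_hom:
  fixes h :: "'a::field \<Rightarrow> 'b::field"
  assumes "field_hom h"
  obtains \<phi> where "\<And>x y. \<phi> (x + y) = \<phi> x + \<phi> y" "\<And>c x. \<phi> (h c * x) = c * \<phi> x" "\<And>c. \<phi> (h c) = c"
proof -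
  interpret h: field_hom h by fact
  interpret p: vector_space_pair "(*) :: 'a \<Rightarrow> 'a \<Rightarrow> 'a" "\<lambda>c x. h c * x"
    by unfold_locales (auto simp: algebra_simps h.hom_add h.hom_mult)
  have lin: "Vector_Spaces.linear (*) (\<lambda>c x. h c * x) h"
    by (simp add: Vector_Spaces.linear_iff p.vs1.vector_space_axioms p.vs2.vector_space_axioms
        h.hom_add h.hom_mult)
  obtain g where g: "Vector_Spaces.linear (\<lambda>c x. h c * x) (*) g" "g \<circ> h = id"
    using p.linear_injective_left_inverse[OF lin] h.inj_f by (auto simp: inj_def)
  show thesis
  proof (rule that)
    show "g (x + y) = g x + g y" for x y using g(1) by (simp add: Vector_Spaces.linear_iff)
    show "g (h c * x) = c * g x" for c x using g(1) by (simp add: Vector_Spaces.linear_iff)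
    show "g (h c) = c" for c using g(2) by (metis comp_apply id_apply)
  qed
qed

text \<open>Linear relations descend along a field extension: apply the retraction \<open>\<phi>\<close> to the
  coefficients, which is compatible with multiplication by scalars of the small field.\<close>

lemma in_span_of_extension:
  assumes h: "field_hom h" and fin: "finite S" and f: "h \<circ> f \<in> fvs.span ((\<circ>) h ` S)"
  shows "f \<in> fvs.span S"
proof -
  obtain \<phi> where \<phi>: "\<And>x y. \<phi> (x + y) = \<phi> x + \<phi> y" "\<And>c x. \<phi> (h c * x) = c * \<phi> x" "\<And>c. \<phi> (h c) = c"
    using retraction_of_field_hom[OF h] by blast
  have \<phi>0: "\<phi> 0 = 0" using \<phi>(2)[of 0 0] by simp
  have \<phi>s: "\<phi> (\<Sum>i\<in>I. g i) = (\<Sum>i\<in>I. \<phi> (g i))" for I and g :: "_ \<Rightarrow> 'b"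
    by (induction I rule: infinite_finite_induct) (auto simp: \<phi>0 \<phi>(1))
  obtain c where c: "h \<circ> f = (\<lambda>x. \<Sum>g\<in>S. c g * (h \<circ> g) x)"
    using in_span_imageE[OF f fin] by blast
  have "f x = (\<Sum>g\<in>S. \<phi> (c g) * g x)" for x
  proof -
    have "f x = \<phi> (\<Sum>g\<in>S. c g * (h \<circ> g) x)" using fun_cong[OF c, of x] \<phi>(3)[of "f x"] by simp
    also have "\<dots> = (\<Sum>g\<in>S. \<phi> (h (g x) * c g))" by (simp add: \<phi>s mult.commute)
    also have "\<dots> = (\<Sum>g\<in>S. \<phi> (c g) * g x)" unfolding \<phi>(2) by (simp only: mult.commute)
    finally show ?thesis .
  qed
  then have "f = (\<lambda>x. \<Sum>g\<in>S. \<phi> (c g) * g x)" by blast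
  also have "\<dots> \<in> fvs.span S" by (intro sum_in_span fvs.span_base)
  finally show ?thesis .
qed

text \<open>By this lemma, dimensions of subspaces over \<open>'a\<close> may be computed over \<open>'b\<close>, where they
  can be compared with the rank of the representing matrix.\<close>

lemma dim_of_extension:
  assumes h: "field_hom h" and fin: "finite S"
  shows "fvs.dim ((\<circ>) h ` S) = fvs.dim S"
proof -
  interpret h: field_hom h by fact
  obtain B where B: "B \<subseteq> S" "fvs.independent B" "S \<subseteq> fvs.span B" "card B = fvs.dim S"
    using fvs.basis_exists .
  have finB: "finite B" using B(1) fin finite_subset by blast
  have inj: "inj ((\<circ>) h)" using h.inj_f by (intro injI) (auto simp: fun_eq_iff)
  have "fvs.dim ((\<circ>) h ` S) = card ((\<circ>) h ` B)"
  proof (rule fvs.dim_unique[OF _ _ _ refl])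
    show "(\<circ>) h ` B \<subseteq> (\<circ>) h ` S" using B(1) by blast
    show "(\<circ>) h ` S \<subseteq> fvs.span ((\<circ>) h ` B)"
    proof clarify
      fix f assume "f \<in> S"
      then have "f \<in> fvs.span ((\<lambda>b. b) ` B)" using B(3) by auto
      then obtain c where c: "f = (\<lambda>x. \<Sum>b\<in>B. c b * b x)" using finB by (rule in_span_imageE)
      have "h \<circ> f = (\<lambda>x. \<Sum>b\<in>B. h (c b) * (h \<circ> b) x)"
        by (simp add: c fun_eq_iff h.hom_sum h.hom_mult)
      also have "\<dots> \<in> fvs.span ((\<circ>) h ` B)"
        by (rule sum_in_span) (rule fvs.span_base[OF imageI])
      finally show "h \<circ> f \<in> fvs.span ((\<circ>) h ` B)" .
    qed
    show "fvs.independent ((\<circ>) h ` B)"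
      unfolding fvs.dependent_def
    proof clarify
      fix b assume b: "b \<in> B" and dep: "h \<circ> b \<in> fvs.span ((\<circ>) h ` B - {h \<circ> b})"
      have "(\<circ>) h ` B - {h \<circ> b} = (\<circ>) h ` (B - {b})" using inj by (auto dest: injD)
      then have "b \<in> fvs.span (B - {b})" using in_span_of_extension[OF h _, of "B - {b}"] dep finB by auto
      with b B(2) show False unfolding fvs.dependent_def by blast
    qed
  qed
  also have "\<dots> = card B" using inj by (metis card_image inj_on_subset subset_UNIV)
  finally show ?thesis using B(4) by simp
qed

section \<open>Ranks of Moore matrices\<close>

text \<open>Linear independence of the family \<open>\<alpha>\<close> on \<open>J\<close> over the fixed field of \<open>\<sigma>\<close>.\<close>

definition indep_over_fixed :: "('b::field \<Rightarrow> 'b) \<Rightarrow> ('j \<Rightarrow> 'b) \<Rightarrow> 'j set \<Rightarrow> bool" where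
  "indep_over_fixed \<sigma> \<alpha> J \<longleftrightarrow>
    (\<forall>c. (\<forall>j\<in>J. \<sigma> (c j) = c j) \<longrightarrow> (\<Sum>j\<in>J. c j * \<alpha> j) = 0 \<longrightarrow> (\<forall>j\<in>J. c j = 0))"

text \<open>Galois descent, in the form that replaces the invertibility of square Moore matrices: if a
  \<open>\<sigma>\<close>-stable subspace contains a combination of \<open>\<sigma>\<close>-fixed vectors whose coefficients are
  independent over the fixed field, it contains these vectors. After one coefficient is scaled
  to \<open>1\<close>, subtracting the image under \<open>\<sigma>\<close> removes the corresponding vector, and the remaining
  coefficients \<open>\<beta> j - \<sigma> (\<beta> j)\<close> are again independent.\<close>

lemma fixed_functions_in_stable_subspace:
  assumes \<sigma>: "field_hom \<sigma>" and fin: "finite J" and indep: "indep_over_fixed \<sigma> \<alpha> J"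
    and R: "fvs.subspace R" and stable: "\<And>f. f \<in> R \<Longrightarrow> \<sigma> \<circ> f \<in> R"
    and z: "\<And>j. j \<in> J \<Longrightarrow> \<sigma> \<circ> z j = z j"
    and w: "(\<lambda>x. \<Sum>j\<in>J. \<alpha> j * z j x) \<in> R"
    and j: "j \<in> J"
  shows "z j \<in> R"
proof -
  interpret \<sigma>: field_hom \<sigma> by fact
  have zx: "\<sigma> (z j x) = z j x" if "j \<in> J" for j x using z[OF that] by (metis comp_apply)
  have "\<forall>j\<in>J. z j \<in> R"
    using fin indep zx w
  proof (induction J arbitrary: \<alpha> rule: finite_induct)
    case (insert n J)
    have \<alpha>n: "\<alpha> n \<noteq> 0"
    proof
      assume "\<alpha> n = 0"
      then have "(\<Sum>j\<in>insert n J. (if j = n then 1 else 0) * \<alpha> j) = 0"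
        by (intro sum.neutral) auto
      moreover note insert.prems(1)[unfolded indep_over_fixed_def, rule_format,
          of "\<lambda>j. if j = n then 1 else 0" n]
      moreover have "\<sigma> (if P then 1 else 0) = (if P then 1 else 0)" for P by simp
      ultimately show False by auto
    qed
    define \<beta> where "\<beta> = (\<lambda>j. \<alpha> j / \<alpha> n)"
    let ?v = "\<lambda>x. (\<Sum>j\<in>J. \<beta> j * z j x)"
    define w where "w = (\<lambda>x. z n x + ?v x)"
    have "w = fscale (1 / \<alpha> n) (\<lambda>x. \<Sum>j\<in>insert n J. \<alpha> j * z j x)"
      using insert.hyps \<alpha>n by (simp add: w_def \<beta>_def fscale_def fun_eq_iff distrib_left sum_distrib_left)
    then have wR: "w \<in> R" using insert.prems(3) fvs.subspace_scale[OF R] by simp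
    have "w - (\<sigma> \<circ> w) \<in> R" using wR stable fvs.subspace_diff[OF R] by blast
    moreover have "w - (\<sigma> \<circ> w) = (\<lambda>x. \<Sum>j\<in>J. (\<beta> j - \<sigma> (\<beta> j)) * z j x)"
      using insert.prems(2)
      by (simp add: w_def fun_eq_iff \<sigma>.hom_add \<sigma>.hom_sum \<sigma>.hom_mult left_diff_distrib sum_subtractf)
    ultimately have u: "(\<lambda>x. \<Sum>j\<in>J. (\<beta> j - \<sigma> (\<beta> j)) * z j x) \<in> R" by simp
    have "indep_over_fixed \<sigma> (\<lambda>j. \<beta> j - \<sigma> (\<beta> j)) J"
      unfolding indep_over_fixed_def
    proof (intro allI impI)
      fix c
      assume c: "\<forall>j\<in>J. \<sigma> (c j) = c j" and s: "(\<Sum>j\<in>J. c j * (\<beta> j - \<sigma> (\<beta> j))) = 0"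
      let ?s = "\<Sum>j\<in>J. c j * \<beta> j"
      have "\<sigma> ?s = (\<Sum>j\<in>J. c j * \<sigma> (\<beta> j))" using c by (simp add: \<sigma>.hom_sum \<sigma>.hom_mult)
      then have fix_s: "\<sigma> ?s = ?s" using s by (simp add: right_diff_distrib sum_subtractf)
      \<comment> \<open>A relation between the differences makes this sum fixed, so it can serve as a coefficient
          in a relation between the \<open>\<alpha> j\<close>.\<close>
      let ?c = "\<lambda>j. if j = n then - ?s else c j"
      have "(\<Sum>j\<in>J. c j * \<alpha> j) = ?s * \<alpha> n"
        using \<alpha>n by (simp add: \<beta>_def sum_distrib_right)
      moreover have "(\<Sum>j\<in>J. ?c j * \<alpha> j) = (\<Sum>j\<in>J. c j * \<alpha> j)"
        using insert.hyps(2) by (intro sum.cong) auto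
      ultimately have "(\<Sum>j\<in>insert n J. ?c j * \<alpha> j) = 0"
        using insert.hyps by simp
      moreover have "\<forall>j\<in>insert n J. \<sigma> (?c j) = ?c j" using c fix_s by (auto simp: \<sigma>.hom_uminus)
      ultimately have "\<forall>j\<in>insert n J. ?c j = 0"
        using insert.prems(1)[unfolded indep_over_fixed_def, THEN spec[of _ ?c]] by blast
      then show "\<forall>j\<in>J. c j = 0" using insert.hyps(2) by (metis insertCI)
    qed
    then have IH: "\<forall>j\<in>J. z j \<in> R" using insert.IH u insert.prems(2) by blast
    have "?v \<in> R"
      using sum_in_span[of J z R \<beta>] IH fvs.span_base fvs.span_minimal[OF subset_refl R] by blast
    then have "w - ?v \<in> R" using wR fvs.subspace_diff[OF R] by blast
    moreover have "w - ?v = z n" by (simp add: w_def fun_eq_iff)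
    ultimately show ?case using IH by simp
  qed simp
  then show ?thesis using j by blast
qed

lemma semilinear_image_of_span:
  fixes f :: "'x \<Rightarrow> 'b::field"
  assumes "field_hom \<sigma>" "f \<in> fvs.span S"
  shows "\<sigma> \<circ> f \<in> fvs.span ((\<circ>) \<sigma> ` S)"
proof -
  interpret \<sigma>: field_hom \<sigma> by fact
  show ?thesis
    using assms(2)
  proof (induction rule: fvs.span_induct_alt)
    case base
    have "\<sigma> \<circ> (0 :: 'x \<Rightarrow> 'b) = 0" by (simp add: fun_eq_iff)
    then show ?case by (simp only: fvs.span_zero)
  next
    case (step c f g)
    have "\<sigma> \<circ> (fscale c f + g) = fscale (\<sigma> c) (\<sigma> \<circ> f) + (\<sigma> \<circ> g)"
      by (simp add: fun_eq_iff fscale_def \<sigma>.hom_add \<sigma>.hom_mult)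
    moreover have "fscale (\<sigma> c) (\<sigma> \<circ> f) \<in> fvs.span ((\<circ>) \<sigma> ` S)"
      using step(1) by (intro fvs.span_scale fvs.span_base) (rule imageI)
    ultimately show ?case using step(2) by (metis fvs.span_add)
  qed
qed

text \<open>The rank property of Moore matrices (that they generate Gabidulin codes), relative to a
  subspace spanned by \<open>\<sigma>\<close>-fixed vectors. Adjoin \<open>w\<close>, \<open>\<sigma> w\<close>, \<open>\<sigma>\<^sup>2 w\<close>, and so on. Either each of the
  \<open>k\<close> conjugates raises the dimension by one, or some conjugate lies in the span of \<open>Y\<close> and the
  preceding ones; then that span is \<open>\<sigma>\<close>-stable and, by descent, contains all the \<open>z j\<close>, so that the
  largest possible dimension is attained.\<close>

lemma dim_with_conjugates:
  fixes z :: "'j \<Rightarrow> 'x \<Rightarrow> 'b::field"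
  assumes \<sigma>: "field_hom \<sigma>" and finJ: "finite J" and indep: "indep_over_fixed \<sigma> \<alpha> J"
    and finY: "finite Y" and Y: "\<And>y. y \<in> Y \<Longrightarrow> \<sigma> \<circ> y = y"
    and z: "\<And>j. j \<in> J \<Longrightarrow> \<sigma> \<circ> z j = z j"
    and w: "w = (\<lambda>x. \<Sum>j\<in>J. \<alpha> j * z j x)"
  shows "fvs.dim (Y \<union> (\<lambda>l. (\<sigma> ^^ l) \<circ> w) ` {..<k}) = min (k + fvs.dim Y) (fvs.dim (Y \<union> z ` J))"
proof -
  interpret \<sigma>: field_hom \<sigma> by fact
  define W where "W = (\<lambda>l. Y \<union> (\<lambda>l. (\<sigma> ^^ l) \<circ> w) ` {..<l})"
  have finW: "finite (W l)" for l using finY by (simp add: W_def)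
  have W_Suc: "W (Suc l) = insert ((\<sigma> ^^ l) \<circ> w) (W l)" for l
    by (auto simp: W_def lessThan_Suc)
  have conj: "(\<sigma> ^^ l) \<circ> w = (\<lambda>x. \<Sum>j\<in>J. (\<sigma> ^^ l) (\<alpha> j) * z j x)" for l
  proof (induction l)
    case (Suc l)
    have "(\<sigma> ^^ Suc l) \<circ> w = \<sigma> \<circ> ((\<sigma> ^^ l) \<circ> w)" by (simp add: comp_assoc)
    also have "\<dots> = \<sigma> \<circ> (\<lambda>x. \<Sum>j\<in>J. (\<sigma> ^^ l) (\<alpha> j) * z j x)" by (simp only: Suc)
    also have "\<dots> = (\<lambda>x. \<Sum>j\<in>J. \<sigma> ((\<sigma> ^^ l) (\<alpha> j)) * \<sigma> (z j x))"
      by (simp add: fun_eq_iff \<sigma>.hom_sum \<sigma>.hom_mult)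
    also have "\<dots> = (\<lambda>x. \<Sum>j\<in>J. (\<sigma> ^^ Suc l) (\<alpha> j) * z j x)"
      using z by (auto simp: fun_eq_iff intro!: sum.cong)
    finally show ?case .
  qed (simp add: w)
  have "(\<sigma> ^^ l) \<circ> w \<in> fvs.span (Y \<union> z ` J)" for l
    unfolding conj by (intro sum_in_span fvs.span_base) auto
  then have "W k \<subseteq> fvs.span (Y \<union> z ` J)"
    unfolding W_def by (auto intro: fvs.span_base)
  then have le1: "fvs.dim (W k) \<le> fvs.dim (Y \<union> z ` J)"
    using finY finJ by (intro fvs.dim_mono_finite) auto
  have "fvs.dim (W k) \<le> fvs.dim Y + fvs.dim ((\<lambda>l. (\<sigma> ^^ l) \<circ> w) ` {..<k})"
    unfolding W_def using finY by (intro fvs.dim_Un_le) auto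
  also have "fvs.dim ((\<lambda>l. (\<sigma> ^^ l) \<circ> w) ` {..<k}) \<le> k"
    using fvs.dim_le_card'[of "(\<lambda>l. (\<sigma> ^^ l) \<circ> w) ` {..<k}"]
      card_image_le[of "{..<k}" "\<lambda>l. (\<sigma> ^^ l) \<circ> w"] by simp
  finally have le2: "fvs.dim (W k) \<le> k + fvs.dim Y" by simp
  have ge: "min (k + fvs.dim Y) (fvs.dim (Y \<union> z ` J)) \<le> fvs.dim (W k)"
  proof (cases "\<exists>l<k. (\<sigma> ^^ l) \<circ> w \<in> fvs.span (W l)")
    case True
    then obtain l where l: "l < k" "(\<sigma> ^^ l) \<circ> w \<in> fvs.span (W l)" by blast
    let ?R = "fvs.span (W l)"
    have "(\<circ>) \<sigma> ` W l \<subseteq> ?R"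
    proof clarify
      fix f assume "f \<in> W l"
      then consider "f \<in> Y" | i where "i < l" "f = (\<sigma> ^^ i) \<circ> w" unfolding W_def by blast
      then show "\<sigma> \<circ> f \<in> ?R"
      proof cases
        case 1
        then show ?thesis using Y by (simp add: W_def fvs.span_base)
      next
        case 2
        have f: "\<sigma> \<circ> f = (\<sigma> ^^ Suc i) \<circ> w" unfolding 2(2) by (simp add: comp_assoc)
        show ?thesis
        proof (cases "Suc i = l")
          case True
          then show ?thesis using l(2) f by simp
        next
          case False
          then have "\<sigma> \<circ> f \<in> W l" using 2(1) f unfolding W_def by (metis Suc_lessI UnI2 imageI lessThan_iff)
          then show ?thesis by (rule fvs.span_base)
        qed
      qed
    qed
    then have "fvs.span ((\<circ>) \<sigma> ` W l) \<subseteq> ?R" by (rule fvs.span_minimal[OF _ fvs.subspace_span])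
    then have stable: "\<sigma> \<circ> f \<in> ?R" if "f \<in> ?R" for f
      using semilinear_image_of_span[OF \<sigma> that] by blast
    have "w \<in> ?R"
    proof (cases "l = 0")
      case True
      then show ?thesis using l(2) by simp
    next
      case False
      then have "(\<sigma> ^^ 0) \<circ> w \<in> W l" unfolding W_def by (metis UnI2 gr0I imageI lessThan_iff)
      then show ?thesis by (simp add: fvs.span_base)
    qed
    then have wR: "(\<lambda>x. \<Sum>j\<in>J. \<alpha> j * z j x) \<in> ?R" by (simp only: w)
    have "z j \<in> ?R" if "j \<in> J" for j
      by (rule fixed_functions_in_stable_subspace[OF \<sigma> finJ indep fvs.subspace_span _ _ wR that])
        (simp_all add: stable z)
    then have "z ` J \<subseteq> ?R" by blast
    moreover have "Y \<subseteq> ?R" unfolding W_def by (auto intro: fvs.span_base)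
    ultimately have "fvs.dim (Y \<union> z ` J) \<le> fvs.dim (W l)"
      using finW by (intro fvs.dim_mono_finite) auto
    also have "\<dots> \<le> fvs.dim (W k)"
      using finW l(1) by (intro fvs.dim_subset_finite) (auto simp: W_def)
    finally show ?thesis by simp
  next
    case False
    have "l \<le> k \<Longrightarrow> fvs.dim (W l) = l + fvs.dim Y" for l
    proof (induction l)
      case 0
      show ?case by (simp add: W_def)
    next
      case (Suc l)
      then have "(\<sigma> ^^ l) \<circ> w \<notin> fvs.span (W l)" using False by simp
      then show ?case using Suc by (simp add: W_Suc fvs.dim_insert_notin_span[OF finW])
    qed
    then show ?thesis by simp
  qed
  show ?thesis using le1 le2 ge by (simp add: W_def)
qed

section \<open>The rank formula of a sum of uniform matroids\<close>

text \<open>The minimum, over all \<open>S \<subseteq> {1..t}\<close>, of \<open>(\<Sum>i\<in>S. k i) + d (T \<union> (\<Union>i\<in>{1..t} - S. B i))\<close>. The recursion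
  decides the membership of the last block in \<open>S\<close> and is all that the inductions use. With
  \<open>d T\<close> the dimension of the projection of a subspace to the coordinates in \<open>T\<close>, and \<open>T = {}\<close>,
  it is the rank of that subspace in the direct sum of the uniform matroids of ranks \<open>k i\<close> on the
  blocks \<open>B i\<close>; a general \<open>T\<close> adds a free block.\<close>

primrec block_rank ::
  "(nat set \<Rightarrow> nat) \<Rightarrow> (nat \<Rightarrow> nat) \<Rightarrow> (nat \<Rightarrow> nat set) \<Rightarrow> nat \<Rightarrow> nat set \<Rightarrow> nat" where
  "block_rank d k B 0 T = d T"
| "block_rank d k B (Suc t) T =
    min (k (Suc t) + block_rank d k B t T) (block_rank d k B t (T \<union> B (Suc t)))"

lemma funpow_power: "((\<lambda>x::'b::monoid_mult. x ^ q) ^^ l) y = y ^ (q ^ l)"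
  by (induction l) (auto simp: power_mult[symmetric] mult.commute)

text \<open>The row with index \<open>l\<close> of the Moore matrix of block \<open>i\<close>, as a function of the vector to which
  it is applied, when the \<open>c j\<close> are coordinate functions with values in the prescribed fixed fields.\<close>

definition block_row :: "(nat \<Rightarrow> 'b::field) \<Rightarrow> (nat \<Rightarrow> 'x \<Rightarrow> 'b) \<Rightarrow> (nat \<Rightarrow> nat set) \<Rightarrow> (nat \<Rightarrow> nat)
    \<Rightarrow> nat \<Rightarrow> nat \<Rightarrow> 'x \<Rightarrow> 'b" where
  "block_row \<alpha> c B Q i l = (\<lambda>x. (\<Sum>j\<in>B i. \<alpha> j * c j x) ^ (Q i ^ l))"

text \<open>The rows of the blocks before the last one, and the coordinates in \<open>T\<close>, are fixed by the
  Frobenius power that belongs to the last block, so \<open>dim_with_conjugates\<close> applies to the last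
  block, and gives precisely the recursion of \<open>block_rank\<close>. The second term of the minimum treats the
  coordinates of the last block as free ones, for which reason \<open>T\<close> is arbitrary.\<close>

lemma dim_block_rows:
  fixes c :: "nat \<Rightarrow> 'x \<Rightarrow> 'b::field"
  assumes frob: "\<And>i. i \<in> {1..t} \<Longrightarrow> field_hom (\<lambda>x::'b. x ^ Q i)"
    and cfix: "\<And>i j x. i \<in> {1..t} \<Longrightarrow> c j x ^ Q i = c j x"
    and \<alpha>fix: "\<And>i i' j. 1 \<le> i' \<Longrightarrow> i' < i \<Longrightarrow> i \<le> t \<Longrightarrow> j \<in> B i' \<Longrightarrow> \<alpha> j ^ Q i = \<alpha> j"
    and indep: "\<And>i. i \<in> {1..t} \<Longrightarrow> indep_over_fixed (\<lambda>x. x ^ Q i) \<alpha> (B i)"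
    and finB: "\<And>i. i \<in> {1..t} \<Longrightarrow> finite (B i)"
    and finT: "finite T"
  shows "fvs.dim ((\<Union>i\<in>{1..t}. block_row \<alpha> c B Q i ` {..<k i}) \<union> c ` T) =
    block_rank (\<lambda>T. fvs.dim (c ` T)) k B t T"
  using assms
proof (induction t arbitrary: T)
  case (Suc t)
  let ?\<sigma> = "\<lambda>x::'b. x ^ Q (Suc t)"
  let ?rows = "\<Union>i\<in>{1..t}. block_row \<alpha> c B Q i ` {..<k i}"
  let ?w = "\<lambda>x. \<Sum>j\<in>B (Suc t). \<alpha> j * c j x"
  have \<sigma>: "field_hom ?\<sigma>" using Suc.prems(1) by simp
  interpret \<sigma>: field_hom ?\<sigma> by fact
  have IH: "fvs.dim (?rows \<union> c ` T) = block_rank (\<lambda>T. fvs.dim (c ` T)) k B t T" if "finite T" for T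
    using Suc.IH[OF _ _ _ _ _ that] Suc.prems(1-5) by simp
  have rows: "block_row \<alpha> c B Q (Suc t) ` {..<k (Suc t)} = (\<lambda>l. (?\<sigma> ^^ l) \<circ> ?w) ` {..<k (Suc t)}"
    by (intro image_cong refl) (simp add: block_row_def fun_eq_iff funpow_power)
  have "fvs.dim ((\<Union>i\<in>{1..Suc t}. block_row \<alpha> c B Q i ` {..<k i}) \<union> c ` T) =
      fvs.dim ((?rows \<union> c ` T) \<union> (\<lambda>l. (?\<sigma> ^^ l) \<circ> ?w) ` {..<k (Suc t)})"
    unfolding rows[symmetric] by (simp add: atLeastAtMostSuc_conv Un_ac)
  also have "\<dots> = min (k (Suc t) + fvs.dim (?rows \<union> c ` T)) (fvs.dim ((?rows \<union> c ` T) \<union> c ` B (Suc t)))"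
  proof (rule dim_with_conjugates[OF \<sigma>, where \<alpha> = \<alpha>])
    show "finite (B (Suc t))" using Suc.prems(5) by simp
    show "indep_over_fixed ?\<sigma> \<alpha> (B (Suc t))" using Suc.prems(4) by simp
    show "finite (?rows \<union> c ` T)" using Suc.prems(6) by simp
    show "?\<sigma> \<circ> c j = c j" for j using Suc.prems(2) by (simp add: fun_eq_iff)
    show "?w = ?w" ..
    show "?\<sigma> \<circ> y = y" if "y \<in> ?rows \<union> c ` T" for y
      using that
    proof
      assume "y \<in> c ` T"
      then show ?thesis using Suc.prems(2) by (auto simp: fun_eq_iff)
    next
      assume "y \<in> ?rows"
      then obtain i l where i: "i \<in> {1..t}" and y: "y = block_row \<alpha> c B Q i l" by blast
      have "?\<sigma> (\<Sum>j\<in>B i. \<alpha> j * c j x) = (\<Sum>j\<in>B i. \<alpha> j * c j x)" for x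
        using i Suc.prems(2)[of "Suc t"] Suc.prems(3)[of i "Suc t"]
        by (simp add: \<sigma>.hom_sum power_mult_distrib)
      then have "(block_row \<alpha> c B Q i l x) ^ Q (Suc t) = block_row \<alpha> c B Q i l x" for x
        unfolding block_row_def power_mult[symmetric] mult.commute[of _ "Q (Suc t)"]
        by (simp only: power_mult)
      then have "?\<sigma> (y x) = y x" for x unfolding y .
      then show ?thesis by (simp add: fun_eq_iff)
    qed
  qed
  also have "(?rows \<union> c ` T) \<union> c ` B (Suc t) = ?rows \<union> c ` (T \<union> B (Suc t))" by blast
  also have "min (k (Suc t) + fvs.dim (?rows \<union> c ` T)) (fvs.dim (?rows \<union> c ` (T \<union> B (Suc t)))) =
      block_rank (\<lambda>T. fvs.dim (c ` T)) k B (Suc t) T"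
    using IH Suc.prems(5,6) by simp
  finally show ?case .
qed simp

section \<open>Coordinate vectors\<close>

text \<open>A vector is regarded as a function on all natural numbers, set to zero outside \<open>T\<close>: in this
  way projections to coordinates become linear endomorphisms of one space, and vectors of different
  lengths live in the same space.\<close>

definition coords :: "nat set \<Rightarrow> 'b::field vec \<Rightarrow> nat \<Rightarrow> 'b" where
  "coords T v = (\<lambda>j. if j \<in> T \<and> j < dim_vec v then v $ j else 0)"

lemma coords_inj_on: "inj_on (coords UNIV) (carrier_vec n)"
  by (intro inj_onI eq_vecI) (auto simp: coords_def fun_eq_iff split: if_splits)

context vec_space
begin

lemma coords_lincomb:
  assumes "S \<subseteq> carrier_vec n" "finite S"
  shows "coords UNIV (lincomb a S) = (\<Sum>v\<in>S. fscale (a v) (coords UNIV v))"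
proof
  fix j
  have d: "dim_vec (lincomb a S) = n" using lincomb_dim[OF assms(2,1)] .
  have dv: "dim_vec v = n" if "v \<in> S" for v using that assms(1) by auto
  show "coords UNIV (lincomb a S) j = (\<Sum>v\<in>S. fscale (a v) (coords UNIV v)) j"
  proof (cases "j < n")
    case True
    then show ?thesis
      using d dv lincomb_index[OF True assms(1), of a]
      by (simp add: coords_def fscale_def fun_sum_apply)
  next
    case False
    then show ?thesis using d dv by (simp add: coords_def fscale_def fun_sum_apply)
  qed
qed

lemma lin_indpt_iff_independent_coords:
  assumes S: "S \<subseteq> carrier_vec n" "finite S"
  shows "lin_indpt S \<longleftrightarrow> fvs.independent (coords UNIV ` S)"
proof -
  have inj: "inj_on (coords UNIV) S" using coords_inj_on S(1) inj_on_subset by blast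
  have zero: "lincomb a S = 0\<^sub>v n \<longleftrightarrow> (\<Sum>v\<in>S. fscale (a v) (coords UNIV v)) = 0" for a
  proof -
    have "coords UNIV (0\<^sub>v n) = (0 :: nat \<Rightarrow> 'a)" by (simp add: coords_def fun_eq_iff)
    moreover have "lincomb a S = 0\<^sub>v n \<longleftrightarrow> coords UNIV (lincomb a S) = coords UNIV (0\<^sub>v n)"
      using inj_on_eq_iff[OF coords_inj_on, of "lincomb a S" n "0\<^sub>v n"] lincomb_closed[OF S(1)] by simp
    ultimately show ?thesis using coords_lincomb[OF S] by simp
  qed
  have "lin_dep S \<longleftrightarrow> (\<exists>a. lincomb a S = 0\<^sub>v n \<and> (\<exists>v\<in>S. a v \<noteq> 0))"
    using finite_lin_dep[OF S(2) _ S(1)] S unfolding lin_dep_def by blast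
  also have "\<dots> \<longleftrightarrow> (\<exists>u. (\<exists>v\<in>S. u (coords UNIV v) \<noteq> 0) \<and>
      (\<Sum>v\<in>S. fscale (u (coords UNIV v)) (coords UNIV v)) = 0)" (is "?l \<longleftrightarrow> ?r")
  proof
    assume ?l
    then obtain a where a: "lincomb a S = 0\<^sub>v n" "\<exists>v\<in>S. a v \<noteq> 0" by blast
    let ?u = "\<lambda>f. a (the_inv_into S (coords UNIV) f)"
    have "?u (coords UNIV v) = a v" if "v \<in> S" for v using the_inv_into_f_f[OF inj that] by simp
    with a zero show ?r by (intro exI[of _ ?u]) (simp cong: sum.cong)
  next
    assume ?r
    then obtain u where u: "\<exists>v\<in>S. u (coords UNIV v) \<noteq> 0"
      "(\<Sum>v\<in>S. fscale (u (coords UNIV v)) (coords UNIV v)) = 0" by blast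
    then show ?l using zero[of "\<lambda>v. u (coords UNIV v)"] by blast
  qed
  also have "\<dots> \<longleftrightarrow> fvs.dependent (coords UNIV ` S)"
    using S(2) by (simp add: fvs.dependent_finite sum.reindex[OF inj])
  finally show ?thesis by blast
qed

lemma dim_span_vs_eq_dim_coords:
  assumes S: "S \<subseteq> carrier_vec n" "finite S"
  shows "vectorspace.dim class_ring (span_vs S) = fvs.dim (coords UNIV ` S)"
proof -
  obtain B where B: "B \<subseteq> coords UNIV ` S" "fvs.independent B" "coords UNIV ` S \<subseteq> fvs.span B"
      "card B = fvs.dim (coords UNIV ` S)"
    using fvs.basis_exists .
  obtain U where U: "U \<subseteq> S" "inj_on (coords UNIV) U" "coords UNIV ` U = B"
    using B(1) unfolding subset_image_inj by metis
  have Ud: "U \<subseteq> carrier_vec n" "finite U" using U(1) S finite_subset by auto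
  have "maximal U (\<lambda>T. T \<subseteq> S \<and> lin_indpt T)"
    unfolding maximal_def
  proof (intro conjI allI impI)
    show "U \<subseteq> S" by fact
    show "lin_indpt U" using lin_indpt_iff_independent_coords[OF Ud] U(3) B(2) by simp
    fix T assume T: "U \<subseteq> T \<and> T \<subseteq> S \<and> lin_indpt T"
    then have "T \<subseteq> carrier_vec n" "finite T" using S finite_subset by auto
    then have ind: "fvs.independent (coords UNIV ` T)" using lin_indpt_iff_independent_coords T by simp
    show "T = U"
    proof (rule ccontr)
      assume "T \<noteq> U"
      then obtain v where v: "v \<in> T" "v \<notin> U" using T by blast
      have "coords UNIV v \<in> fvs.span (coords UNIV ` U)" using v(1) T B(3) U(3) by blast
      moreover have "coords UNIV ` U \<subseteq> coords UNIV ` T - {coords UNIV v}"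
      proof clarify
        fix u assume u: "u \<in> U"
        have "coords UNIV u \<noteq> coords UNIV v"
          using inj_onD[OF coords_inj_on, of u v n] u v T S(1) by blast
        then show "coords UNIV u \<in> coords UNIV ` T - {coords UNIV v}" using u T by blast
      qed
      ultimately have "coords UNIV v \<in> fvs.span (coords UNIV ` T - {coords UNIV v})"
        using fvs.span_mono by blast
      then show False using ind v(1) unfolding fvs.dependent_def by blast
    qed
  qed
  then have "vectorspace.dim class_ring (span_vs S) = card U"
    using dim_span[OF _ S(2), of U] S(1) by simp
  also have "\<dots> = card B" using card_image[OF U(2)] U(3) by simp
  finally show ?thesis using B(4) by simp
qed

lemma rank_eq_dim_coords:
  assumes "A \<in> carrier_mat n nc"
  shows "rank A = fvs.dim (coords UNIV ` set (cols A))"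
  unfolding rank_def using assms cols_dim[of A] by (intro dim_span_vs_eq_dim_coords) auto

end

lemma finite_carrier_vec: "finite (carrier_vec n :: 'a::finite vec set)"
proof -
  have "carrier_vec n \<subseteq> vec_of_list ` {xs :: 'a list. set xs \<subseteq> UNIV \<and> length xs = n}"
  proof
    fix v :: "'a vec" assume "v \<in> carrier_vec n"
    then show "v \<in> vec_of_list ` {xs. set xs \<subseteq> UNIV \<and> length xs = n}"
      by (intro image_eqI[of _ _ "list_of_vec v"]) (auto simp: vec_list)
  qed
  then show ?thesis
    by (rule finite_subset) (intro finite_imageI finite_lists_length_eq finite)
qed

lemma subspaces_iff:
  "V \<in> subspaces n \<longleftrightarrow> V \<subseteq> carrier_vec n \<and> 0\<^sub>v n \<in> V \<and>
    (\<forall>v\<in>V. \<forall>w\<in>V. v + w \<in> V) \<and> (\<forall>c. \<forall>v\<in>V. c \<cdot>\<^sub>v v \<in> V)" for V :: "'a::field vec set"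
proof -
  interpret vec_space "TYPE('a)" n .
  show ?thesis
    unfolding subspaces_def VectorSpace.subspace_def submodule_def
    using vec_vs[of n, where ?'a = 'a] vec_module[of n, where ?'a = 'a]
    by (auto simp: module_vec_simps class_ring_simps)
qed

lemma vdim_eq_dim_coords:
  fixes V :: "'a::{finite,field} vec set"
  assumes V: "V \<in> subspaces n"
  shows "vdim n V = fvs.dim (coords UNIV ` V)"
proof -
  interpret vec_space "TYPE('a)" n .
  have sub: "V \<subseteq> carrier_vec n" using V by (simp add: subspaces_iff)
  have "span V = V"
    using V sub span_is_subset[of V V] in_own_span[of V]
    unfolding subspaces_def VectorSpace.subspace_def by auto
  then show ?thesis
    using dim_span_vs_eq_dim_coords[OF sub finite_subset[OF sub finite_carrier_vec]]
    by (simp add: vdim_def)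
qed


text \<open>Row rank equals column rank, for the matrix whose columns are the \<open>\<phi> v\<close> with \<open>v \<in> U\<close>. It is
  used in this form to pass from the dimension of the image of a subspace \<open>U\<close> to that of the
  functions that the rows define on \<open>U\<close>.\<close>

lemma dim_image_eq_dim_rows:
  assumes "finite U" "finite I" "\<And>v i. v \<in> U \<Longrightarrow> i \<notin> I \<Longrightarrow> \<phi> v i = 0"
  shows "fvs.dim (\<phi> ` U) = fvs.dim ((\<lambda>i v. if v \<in> U then \<phi> v i else 0) ` I)"
proof -
  let ?M = "\<lambda>i v. if v \<in> U then \<phi> v i else 0"
  have insert_0: "fvs.dim (insert 0 S) = fvs.dim S" for S :: "('d \<Rightarrow> 'e::field) set"
    by (rule fvs.span_eq_dim) (rule fvs.span_insert_0)
  have rows: "insert 0 (range ?M) = insert 0 (?M ` I)"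
  proof -
    have "?M i = 0" if "i \<notin> I" for i using assms(3) that by (auto simp: fun_eq_iff)
    then show ?thesis by (auto simp: image_iff)
  qed
  have cols: "insert 0 (range (\<lambda>v i. ?M i v)) = insert 0 (\<phi> ` U)"
  proof -
    have "(\<lambda>i. ?M i v) = (if v \<in> U then \<phi> v else 0)" for v by (auto simp: fun_eq_iff)
    then show ?thesis by (auto simp: image_iff)
  qed
  have "finite (insert 0 (range ?M))" "finite (insert 0 (range (\<lambda>v i. ?M i v)))"
    unfolding rows cols using assms(1,2) by auto
  then have fin: "finite (range ?M)" "finite (range (\<lambda>v i. ?M i v))"
    by (simp_all only: finite_insert)
  have "fvs.dim (\<phi> ` U) = fvs.dim (range (\<lambda>v i. ?M i v))"
    using insert_0[of "\<phi> ` U"] insert_0[of "range (\<lambda>v i. ?M i v)"] cols by simp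
  also have "\<dots> = fvs.dim (range ?M)" using dim_rows_eq_dim_columns[OF fin] by simp
  also have "\<dots> = fvs.dim (?M ` I)"
    using insert_0[of "?M ` I"] insert_0[of "range ?M"] rows by simp
  finally show ?thesis .
qed

section \<open>The matroid of a matrix\<close>

definition mat_image :: "('a::field \<Rightarrow> 'b::field) \<Rightarrow> 'b mat \<Rightarrow> 'a vec \<Rightarrow> nat \<Rightarrow> 'b" where
  "mat_image h G v = coords UNIV (G *\<^sub>v map_vec h v)"

definition mat_fun :: "'b::field mat \<Rightarrow> (nat \<Rightarrow> 'b) \<Rightarrow> nat \<Rightarrow> 'b" where
  "mat_fun G f = (\<lambda>i. if i < dim_row G then \<Sum>j<dim_col G. G $$ (i, j) * f j else 0)"

lemma linear_mat_fun: "Vector_Spaces.linear fscale fscale (mat_fun G)"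
  unfolding linear_fun_iff
  by (auto simp: mat_fun_def fscale_def fun_eq_iff distrib_left sum.distrib sum_distrib_left
      intro!: sum.cong)

lemma mat_image_eq_mat_fun:
  assumes "v \<in> carrier_vec (dim_col G)"
  shows "mat_image h G v = mat_fun G (h \<circ> coords UNIV v)"
  using assms
  by (auto simp: mat_image_def mat_fun_def coords_def fun_eq_iff scalar_prod_def
      atLeast0LessThan intro!: sum.cong)

lemma mat_image_in_span:
  fixes v :: "'a::field vec"
  assumes h: "field_hom h" and v: "v \<in> carrier_vec (dim_col G)" and S: "S \<subseteq> carrier_vec (dim_col G)"
    and vS: "coords UNIV v \<in> fvs.span (coords UNIV ` S)"
  shows "mat_image h G v \<in> fvs.span (mat_image h G ` S)"
proof -
  have "h \<circ> coords UNIV v \<in> fvs.span ((\<circ>) h ` coords UNIV ` S)"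
    by (rule semilinear_image_of_span[OF h vS])
  then have "mat_fun G (h \<circ> coords UNIV v) \<in> fvs.span (mat_fun G ` (\<circ>) h ` coords UNIV ` S)"
    using fvp.linear_span_image[OF linear_mat_fun] by blast
  also have "mat_fun G ` (\<circ>) h ` coords UNIV ` S = mat_image h G ` S"
    unfolding image_image using mat_image_eq_mat_fun S by (metis (no_types, lifting) image_cong subsetD)
  finally show ?thesis using mat_image_eq_mat_fun[OF v] by metis
qed

context vec_space
begin

lemma coords_in_span:
  assumes S: "S \<subseteq> carrier_vec n" and v: "v \<in> span S"
  shows "coords UNIV v \<in> fvs.span (coords UNIV ` S)"
proof -
  obtain a A where A: "finite A" "A \<subseteq> S" "v = lincomb a A"
    using v unfolding span_def by blast
  then have "A \<subseteq> carrier_vec n" using S by blast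
  then have "coords UNIV v = (\<Sum>u\<in>A. fscale (a u) (coords UNIV u))"
    using coords_lincomb A by simp
  also have "\<dots> \<in> fvs.span (coords UNIV ` S)"
    using A(2) by (intro fvs.span_sum fvs.span_scale fvs.span_base) blast
  finally show ?thesis .
qed

end

lemma basis_mat_of_subspace:
  fixes U :: "'a::{finite,field} vec set"
  assumes U: "U \<in> subspaces n"
  shows "dim_row (basis_mat n U) = n" "set (cols (basis_mat n U)) \<subseteq> U"
    "\<And>u. u \<in> U \<Longrightarrow> coords UNIV u \<in> fvs.span (coords UNIV ` set (cols (basis_mat n U)))"
proof -
  interpret vec_space "TYPE('a)" n .
  have sub: "U \<subseteq> carrier_vec n" using U by (simp add: subspaces_iff)
  have subm: "submodule class_ring U V" using U unfolding subspaces_def VectorSpace.subspace_def by simp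
  have span_U: "span U = U"
    using subm sub span_is_subset[of U U] in_own_span[of U] by auto
  have vs: "vectorspace class_ring (vs U)"
    using U unfolding subspaces_def by (simp add: subspace_is_vs)
  have "vectorspace.fin_dim class_ring (vs U)"
    using fin_dim_span[of U] finite_subset[OF sub finite_carrier_vec] sub span_U by simp
  then obtain \<beta> where \<beta>: "finite \<beta>" "vectorspace.basis class_ring (vs U) \<beta>"
    using vectorspace.finite_basis_exists[OF vs] by blast
  have basis: "\<beta> \<subseteq> U \<and> span \<beta> = U" if "vectorspace.basis class_ring (vs U) \<beta>" for \<beta>
  proof -
    have "\<beta> \<subseteq> U" using that unfolding vectorspace.basis_def[OF vs] by simp
    then show ?thesis
      using that span_li_not_depend(1)[OF _ subm] unfolding vectorspace.basis_def[OF vs] by auto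
  qed
  obtain xs where xs: "set xs = \<beta>" "distinct xs" using finite_distinct_list[OF \<beta>(1)] by blast
  have "cols (mat_of_cols n xs) = xs"
    using basis[OF \<beta>(2)] sub xs(1) by (intro cols_mat_of_cols) auto
  then have "is_basis_mat n U (mat_of_cols n xs)"
    using \<beta>(2) xs by (simp add: is_basis_mat_def)
  then have ib: "is_basis_mat n U (basis_mat n U)" unfolding basis_mat_def by (rule someI)
  then show "dim_row (basis_mat n U) = n" by (simp add: is_basis_mat_def)
  have b: "set (cols (basis_mat n U)) \<subseteq> U \<and> span (set (cols (basis_mat n U))) = U"
    using ib basis by (simp add: is_basis_mat_def)
  then show "set (cols (basis_mat n U)) \<subseteq> U" by blast
  show "coords UNIV u \<in> fvs.span (coords UNIV ` set (cols (basis_mat n U)))" if "u \<in> U" for u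
    using coords_in_span[of "set (cols (basis_mat n U))" u] b that sub by blast
qed

text \<open>The value at \<open>U\<close> of the rank function of the matroid of \<open>G\<close>, in a form that does not refer to
  a basis of \<open>U\<close>: a basis over \<open>'a\<close> generates all of \<open>U\<close>, hence its image under \<open>G\<close>
  generates the image of \<open>U\<close> over \<open>'b\<close>.\<close>

lemma rank_on_subspace:
  fixes h :: "'a::{finite,field} \<Rightarrow> 'b::field"
  assumes h: "field_hom h" and U: "U \<in> subspaces (dim_col G)"
  shows "vec_space.rank (dim_row G) (G * map_mat h (basis_mat (dim_col G) U)) =
    fvs.dim (mat_image h G ` U)"
proof -
  let ?A = "basis_mat (dim_col G) U"
  let ?C = "set (cols ?A)"
  note A = basis_mat_of_subspace[OF U]
  have sub: "U \<subseteq> carrier_vec (dim_col G)" using U by (simp add: subspaces_iff)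
  have finU: "finite U" using finite_subset[OF sub finite_carrier_vec] .
  have "cols (G * map_mat h ?A) = map (\<lambda>b. G *\<^sub>v map_vec h b) (cols ?A)"
    using A(1) by (intro nth_equalityI) (auto simp: cols_nth)
  then have "coords UNIV ` set (cols (G * map_mat h ?A)) = mat_image h G ` ?C"
    by (auto simp: mat_image_def image_image)
  moreover have "G * map_mat h ?A \<in> carrier_mat (dim_row G) (dim_col ?A)" by (intro carrier_matI) auto
  ultimately have "vec_space.rank (dim_row G) (G * map_mat h ?A) = fvs.dim (mat_image h G ` ?C)"
    using vec_space.rank_eq_dim_coords[of "G * map_mat h ?A" "dim_row G" "dim_col ?A"] by simp
  also have "\<dots> = fvs.dim (mat_image h G ` U)"
  proof (rule antisym)
    show "fvs.dim (mat_image h G ` ?C) \<le> fvs.dim (mat_image h G ` U)"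
      using A(2) finU by (intro fvs.dim_subset_finite) auto
    have "mat_image h G ` U \<subseteq> fvs.span (mat_image h G ` ?C)"
      using mat_image_in_span[OF h _ _ A(3)] A(2) sub by blast
    then show "fvs.dim (mat_image h G ` U) \<le> fvs.dim (mat_image h G ` ?C)"
      by (intro fvs.dim_mono_finite) auto
  qed
  finally show ?thesis .
qed

lemma subspaces_Int: "A \<in> subspaces n \<Longrightarrow> B \<in> subspaces n \<Longrightarrow> A \<inter> B \<in> subspaces n"
  by (auto simp: subspaces_iff)

lemma carrier_vec_in_subspaces: "carrier_vec n \<in> subspaces n"
  by (simp add: subspaces_iff)

lemma subspaces_sum:
  fixes A B :: "'a::field vec set"
  assumes A: "A \<in> subspaces n" and B: "B \<in> subspaces n"
  shows "{a + b |a b. a \<in> A \<and> b \<in> B} \<in> subspaces n"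
  unfolding subspaces_iff
proof (intro conjI ballI allI)
  have sub: "A \<subseteq> carrier_vec n" "B \<subseteq> carrier_vec n" using A B by (simp_all add: subspaces_iff)
  show "{a + b |a b. a \<in> A \<and> b \<in> B} \<subseteq> carrier_vec n"
    using sub by (auto intro!: add_carrier_vec)
  have "0\<^sub>v n = 0\<^sub>v n + (0\<^sub>v n :: 'a vec)" by simp
  then show "0\<^sub>v n \<in> {a + b |a b. a \<in> A \<and> b \<in> B}" using A B unfolding subspaces_iff by blast
  show "c \<cdot>\<^sub>v v \<in> {a + b |a b. a \<in> A \<and> b \<in> B}" if v: "v \<in> {a + b |a b. a \<in> A \<and> b \<in> B}" for c v
  proof -
    obtain a b where ab: "v = a + b" "a \<in> A" "b \<in> B" using v by blast
    have "c \<cdot>\<^sub>v v = c \<cdot>\<^sub>v a + c \<cdot>\<^sub>v b"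
      unfolding ab(1) using ab sub by (intro smult_add_distrib_vec) auto
    then show ?thesis using A B ab unfolding subspaces_iff by blast
  qed
  show "v + w \<in> {a + b |a b. a \<in> A \<and> b \<in> B}"
    if v: "v \<in> {a + b |a b. a \<in> A \<and> b \<in> B}" and w: "w \<in> {a + b |a b. a \<in> A \<and> b \<in> B}" for v w
  proof -
    obtain a b where ab: "v = a + b" "a \<in> A" "b \<in> B" using v by blast
    obtain a' b' where ab': "w = a' + b'" "a' \<in> A" "b' \<in> B" using w by blast
    have "a \<in> carrier_vec n" "b \<in> carrier_vec n" "a' \<in> carrier_vec n" "b' \<in> carrier_vec n"
      using ab(2,3) ab'(2,3) sub by blast+
    then have "v + w = (a + a') + (b + b')"
      unfolding ab(1) ab'(1) by (intro eq_vecI) auto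
    then show ?thesis using A B ab ab' unfolding subspaces_iff by blast
  qed
qed

lemma q_matroid_matrix_qm:
  fixes h :: "'a::{finite,field} \<Rightarrow> 'b::field"
  assumes h: "field_hom h"
  shows "q_matroid (matrix_qm h G)"
proof -
  interpret h: field_hom h by fact
  let ?n = "dim_col G"
  let ?\<phi> = "mat_image h G"
  define \<rho> where "\<rho> = rank_fun (matrix_qm h G)"
  have \<rho>: "\<rho> A = int (fvs.dim (?\<phi> ` A))" if "A \<in> subspaces ?n" for A
    using that rank_on_subspace[OF h that] by (simp add: \<rho>_def matrix_qm_def)
  have sub: "A \<subseteq> carrier_vec ?n" if "A \<in> subspaces ?n" for A :: "'a vec set"
    using that by (simp add: subspaces_iff)
  have fin: "finite A" if "A \<in> subspaces ?n" for A :: "'a vec set"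
    using finite_subset[OF sub[OF that] finite_carrier_vec] .
  have "\<rho> \<in> extensional (subspaces ?n)" by (simp add: \<rho>_def matrix_qm_def)
  moreover have "\<rho> A \<le> int (vdim ?n A)" if A: "A \<in> subspaces ?n" for A
  proof -
    have "?\<phi> ` A = mat_fun G ` (\<circ>) h ` coords UNIV ` A"
      unfolding image_image using mat_image_eq_mat_fun sub[OF A] by (intro image_cong) auto
    then have "fvs.dim (?\<phi> ` A) \<le> fvs.dim ((\<circ>) h ` coords UNIV ` A)"
      by (simp only:) (intro fvp.dim_image_le_finite linear_mat_fun finite_imageI fin A)
    also have "\<dots> = vdim ?n A" using dim_of_extension[OF h, of "coords UNIV ` A"] fin[OF A] vdim_eq_dim_coords[OF A] by simp
    finally show ?thesis using \<rho>[OF A] by simp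
  qed
  moreover have "\<rho> A \<le> \<rho> B" if "A \<in> subspaces ?n" "B \<in> subspaces ?n" "A \<subseteq> B" for A B
    using that \<rho> fin by (simp add: fvs.dim_subset_finite image_mono)
  moreover have "\<rho> {a + b |a b. a \<in> A \<and> b \<in> B} + \<rho> (A \<inter> B) \<le> \<rho> A + \<rho> B"
    if A: "A \<in> subspaces ?n" and B: "B \<in> subspaces ?n" for A B
  proof -
    let ?S = "{a + b |a b. a \<in> A \<and> b \<in> B}"
    have "?\<phi> ` ?S \<subseteq> fvs.span (?\<phi> ` A \<union> ?\<phi> ` B)"
    proof clarify
      fix a b assume ab: "a \<in> A" "b \<in> B"
      then have "a \<in> carrier_vec ?n" "b \<in> carrier_vec ?n" using sub A B by auto
      then have "?\<phi> (a + b) = ?\<phi> a + ?\<phi> b"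
        by (auto simp: mat_image_eq_mat_fun mat_fun_def coords_def fun_eq_iff h.hom_add
            distrib_left sum.distrib)
      also have "\<dots> \<in> fvs.span (?\<phi> ` A \<union> ?\<phi> ` B)"
        using ab by (intro fvs.span_add fvs.span_base) auto
      finally show "?\<phi> (a + b) \<in> fvs.span (?\<phi> ` A \<union> ?\<phi> ` B)" .
    qed
    then have "fvs.dim (?\<phi> ` ?S) \<le> fvs.dim (?\<phi> ` A \<union> ?\<phi> ` B)"
      using fin A B by (intro fvs.dim_mono_finite) auto
    moreover have "fvs.dim (?\<phi> ` A \<union> ?\<phi> ` B) + fvs.dim (?\<phi> ` (A \<inter> B)) \<le>
        fvs.dim (?\<phi> ` A) + fvs.dim (?\<phi> ` B)"
      using fin A B by (intro fvs.dim_submodular) (auto intro: fvs.span_base)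
    ultimately show ?thesis
      using \<rho>[OF A] \<rho>[OF B] \<rho>[OF subspaces_sum[OF A B]] \<rho>[OF subspaces_Int[OF A B]] by simp
  qed
  ultimately show ?thesis
    using \<rho> unfolding q_matroid_def Let_def \<rho>_def[symmetric] by (simp add: matrix_qm_def)
qed

lemma rank_eq_qm_rank:
  fixes h :: "'a::{finite,field} \<Rightarrow> 'b::field"
  assumes h: "field_hom h"
  shows "int (vec_space.rank (dim_row G) G) = qm_rank (matrix_qm h G)"
proof -
  interpret h: field_hom h by fact
  let ?n = "dim_col G"
  let ?\<phi> = "mat_image h G"
  have "fvs.dim (?\<phi> ` carrier_vec ?n) = fvs.dim (coords UNIV ` set (cols G))"
  proof (rule antisym)
    have "coords UNIV ` set (cols G) \<subseteq> ?\<phi> ` carrier_vec ?n"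
    proof clarify
      fix c assume "c \<in> set (cols G)"
      then obtain j where j: "j < ?n" "c = col G j" by (auto simp: in_set_conv_nth cols_nth)
      have "map_vec h (unit_vec ?n j) = unit_vec ?n j"
        by (intro eq_vecI) (auto simp: unit_vec_def)
      moreover have "G *\<^sub>v unit_vec ?n j = col G j"
        using j by (intro eq_vecI) auto
      ultimately have "coords UNIV c = ?\<phi> (unit_vec ?n j)"
        using j by (simp add: mat_image_def)
      then show "coords UNIV c \<in> ?\<phi> ` carrier_vec ?n" using j by auto
    qed
    then show "fvs.dim (coords UNIV ` set (cols G)) \<le> fvs.dim (?\<phi> ` carrier_vec ?n)"
      by (intro fvs.dim_subset_finite) (simp_all add: finite_carrier_vec)
    have "?\<phi> ` carrier_vec ?n \<subseteq> fvs.span (coords UNIV ` set (cols G))"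
    proof clarify
      fix v :: "'a vec" assume v: "v \<in> carrier_vec ?n"
      have "?\<phi> v = (\<lambda>i. \<Sum>j<?n. h (v $ j) * coords UNIV (col G j) i)"
        unfolding mat_image_eq_mat_fun[OF v] using v
        by (auto simp: mat_fun_def coords_def fun_eq_iff mult.commute intro!: sum.cong)
      also have "\<dots> \<in> fvs.span (coords UNIV ` set (cols G))"
        by (intro sum_in_span fvs.span_base) (auto simp: cols_def)
      finally show "?\<phi> v \<in> fvs.span (coords UNIV ` set (cols G))" .
    qed
    then show "fvs.dim (?\<phi> ` carrier_vec ?n) \<le> fvs.dim (coords UNIV ` set (cols G))"
      by (intro fvs.dim_mono_finite) auto
  qed
  then have *: "fvs.dim (?\<phi> ` carrier_vec ?n) = vec_space.rank (dim_row G) G"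
    by (simp only: vec_space.rank_eq_dim_coords[OF carrier_matI[OF refl refl]])
  have "qm_rank (matrix_qm h G) =
      int (vec_space.rank (dim_row G) (G * map_mat h (basis_mat ?n (carrier_vec ?n))))"
    unfolding qm_rank_def matrix_qm_def by (simp only: qmatroid.sel restrict_apply
        carrier_vec_in_subspaces if_True)
  then show ?thesis
    by (simp only: rank_on_subspace[OF h carrier_vec_in_subspaces] *)
qed

section \<open>The rank function of the direct sum\<close>

definition restr :: "nat set \<Rightarrow> (nat \<Rightarrow> 'b::field) \<Rightarrow> nat \<Rightarrow> 'b" where
  "restr T f = (\<lambda>j. if j \<in> T then f j else 0)"

lemma linear_restr: "Vector_Spaces.linear fscale fscale (restr T)"
  by (auto simp: linear_fun_iff restr_def fscale_def fun_eq_iff)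

lemma restr_coords: "restr T (coords T' v) = coords (T \<inter> T') v"
  by (auto simp: restr_def coords_def fun_eq_iff)

lemma restr_coords_image: "restr T ` coords T' ` V = coords (T \<inter> T') ` V"
  by (simp add: image_image restr_coords)

abbreviation coord_dim :: "'a::field vec set \<Rightarrow> nat set \<Rightarrow> nat" where
  "coord_dim V T \<equiv> fvs.dim (coords T ` V)"

lemma coord_dim_mono:
  assumes "finite V" "T \<subseteq> T'"
  shows "coord_dim V T \<le> coord_dim V T'"
proof -
  have "coords T ` V = restr T ` coords T' ` V"
    using assms(2) by (simp add: restr_coords_image Int_absorb2)
  then show ?thesis
    using fvp.dim_image_le_finite[OF linear_restr[of T], of "coords T' ` V"] assms(1) by simp
qed

lemma coord_dim_Un_le:
  assumes "finite V"
  shows "coord_dim V (T \<union> T') \<le> coord_dim V T + coord_dim V T'"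
proof -
  have "coords (T \<union> T') ` V \<subseteq> fvs.span (coords T ` V \<union> coords (T' - T) ` V)"
  proof clarify
    fix v assume "v \<in> V"
    moreover have "coords (T \<union> T') v = coords T v + coords (T' - T) v"
      by (auto simp: coords_def fun_eq_iff)
    ultimately show "coords (T \<union> T') v \<in> fvs.span (coords T ` V \<union> coords (T' - T) ` V)"
      by (simp add: fvs.span_add fvs.span_base)
  qed
  then have "coord_dim V (T \<union> T') \<le> fvs.dim (coords T ` V \<union> coords (T' - T) ` V)"
    using assms by (intro fvs.dim_mono_finite) auto
  also have "\<dots> \<le> coord_dim V T + coord_dim V (T' - T)"
    using assms by (intro fvs.dim_Un_le) auto
  also have "coord_dim V (T' - T) \<le> coord_dim V T'" using assms by (intro coord_dim_mono) auto
  finally show ?thesis by simp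
qed

lemma coord_dim_diff_mono:
  assumes "finite V" "W \<subseteq> V"
  shows "coord_dim V T + coord_dim W UNIV \<le> coord_dim W T + coord_dim V UNIV"
  using fvp.dim_image_diff_mono[OF linear_restr, of "coords UNIV ` V" "coords UNIV ` W" T] assms
  by (simp add: restr_coords_image image_mono)

lemma coord_dim_UNIV:
  assumes "V \<subseteq> carrier_vec n"
  shows "coord_dim V UNIV = coord_dim V {..<n}"
proof -
  have "coords UNIV v = coords {..<n} v" if "v \<in> V" for v
    using that assms by (auto simp: coords_def fun_eq_iff)
  then show ?thesis by (metis (no_types, lifting) image_cong)
qed

lemma coord_dim_empty: "coord_dim V {} = 0"
proof -
  have "coords {} ` V \<subseteq> fvs.span {}" by (auto simp: coords_def fun_eq_iff)
  then show ?thesis using fvs.dim_le_card[of "coords {} ` V" "{}"] by simp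
qed

text \<open>Here \<open>W\<close> is the kernel in \<open>V\<close> of the projection to the coordinates in \<open>T\<close>.\<close>

lemma coordinate_kernel:
  fixes V :: "'a::{finite,field} vec set"
  assumes V: "V \<in> subspaces n"
  obtains W where "W \<in> subspaces n" "W \<subseteq> V" "coord_dim W T = 0"
    "coord_dim V UNIV \<le> coord_dim W UNIV + coord_dim V T"
proof -
  let ?W = "{v \<in> V. coords T v = 0}"
  have sub: "V \<subseteq> carrier_vec n" using V by (simp add: subspaces_iff)
  have dim: "dim_vec v = n" if "v \<in> V" for v using that sub by auto
  have fin: "finite V" using finite_subset[OF sub finite_carrier_vec] .
  have add: "coords T (v + w) = coords T v + coords T w" if "v \<in> V" "w \<in> V" for v w and T
    using dim[OF that(1)] dim[OF that(2)] by (auto simp: coords_def fun_eq_iff)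
  have smult: "coords T (c \<cdot>\<^sub>v v) = fscale c (coords T v)" for c T and v :: "'a vec"
    by (auto simp: coords_def fscale_def fun_eq_iff)
  have zero: "coords T (0\<^sub>v n) = (0 :: nat \<Rightarrow> 'a)" for T by (auto simp: coords_def fun_eq_iff)
  show ?thesis
  proof (rule that)
    show "?W \<in> subspaces n"
      using V by (auto simp: subspaces_iff add smult zero)
    show "?W \<subseteq> V" by blast
    have "coords T ` ?W \<subseteq> fvs.span {}" by auto
    then show "coord_dim ?W T = 0" using fvs.dim_le_card[of "coords T ` ?W" "{}"] by simp
    have "fvs.subspace (coords UNIV ` V)"
      unfolding fvs.subspace_def
    proof (intro conjI ballI allI)
      show "0 \<in> coords UNIV ` V" using V zero[of UNIV] unfolding subspaces_iff by (metis imageI)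
      show "x + y \<in> coords UNIV ` V" if xy: "x \<in> coords UNIV ` V" "y \<in> coords UNIV ` V" for x y
      proof -
        obtain v w where vw: "v \<in> V" "w \<in> V" "x = coords UNIV v" "y = coords UNIV w" using xy by blast
        then have "x + y = coords UNIV (v + w)" by (simp add: add)
        then show ?thesis using V vw(1,2) unfolding subspaces_iff by blast
      qed
      show "fscale c x \<in> coords UNIV ` V" if x: "x \<in> coords UNIV ` V" for c x
      proof -
        obtain v where v: "v \<in> V" "x = coords UNIV v" using x by blast
        then have "fscale c x = coords UNIV (c \<cdot>\<^sub>v v)" by (simp add: smult)
        then show ?thesis using V v(1) unfolding subspaces_iff by blast
      qed
    qed
    then have "coord_dim V UNIV \<le> fvs.dim {u \<in> coords UNIV ` V. restr T u = 0} +
        fvs.dim (restr T ` coords UNIV ` V)"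
      using fin by (intro fvp.dim_le_kernel_plus_image linear_restr) auto
    also have "{u \<in> coords UNIV ` V. restr T u = 0} = coords UNIV ` ?W"
      by (auto simp: restr_coords)
    finally show "coord_dim V UNIV \<le> coord_dim ?W UNIV + coord_dim V T"
      by (simp add: restr_coords_image)
  qed
qed

lemma block_rank_diff_mono:
  assumes "finite V" "W \<subseteq> V"
  shows "block_rank (coord_dim V) k B t T + coord_dim W UNIV \<le>
    block_rank (coord_dim W) k B t T + coord_dim V UNIV"
proof (induction t arbitrary: T)
  case 0
  then show ?case using coord_dim_diff_mono[OF assms] by simp
next
  case (Suc t)
  show ?case using Suc[of T] Suc[of "T \<union> B (Suc t)"] by simp
qed

lemma block_rank_Un_le:
  assumes "finite V"
  shows "block_rank (coord_dim V) k B t (T \<union> T') \<le> block_rank (coord_dim V) k B t T + coord_dim V T'"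
proof (induction t arbitrary: T)
  case 0
  then show ?case using coord_dim_Un_le[OF assms] by simp
next
  case (Suc t)
  have "T \<union> T' \<union> B (Suc t) = T \<union> B (Suc t) \<union> T'" by blast
  then show ?case using Suc[of T] Suc[of "T \<union> B (Suc t)"] by simp
qed

text \<open>This lemma provides the subspace at which the minimum in the definition of the direct sum is
  attained: if \<open>block_rank\<close> selects the coordinates \<open>T'\<close> in its minimum, take the
  kernel in \<open>V\<close> of the projection to \<open>T'\<close>.\<close>

lemma block_rank_attained:
  fixes V :: "'a::{finite,field} vec set"
  assumes V: "V \<in> subspaces n"
  shows "\<exists>W. W \<in> subspaces n \<and> W \<subseteq> V \<and> coord_dim W T = 0 \<and>
    block_rank (coord_dim W) k B t {} + coord_dim V UNIV \<le>
    block_rank (coord_dim V) k B t T + coord_dim W UNIV"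
proof (induction t arbitrary: T)
  case 0
  obtain W where "W \<in> subspaces n" "W \<subseteq> V" "coord_dim W T = 0"
    "coord_dim V UNIV \<le> coord_dim W UNIV + coord_dim V T"
    using coordinate_kernel[OF V] .
  then show ?case by (intro exI[of _ W]) (simp add: coord_dim_empty)
next
  case (Suc t)
  let ?r = "\<lambda>V. block_rank (coord_dim V) k B t"
  have fin: "finite W" if "W \<subseteq> V" for W
  proof -
    have "W \<subseteq> carrier_vec n" using that V by (auto simp: subspaces_iff)
    then show ?thesis by (rule finite_subset) (rule finite_carrier_vec)
  qed
  show ?case
  proof (cases "k (Suc t) + ?r V T \<le> ?r V (T \<union> B (Suc t))")
    case True
    obtain W where "W \<in> subspaces n" "W \<subseteq> V" "coord_dim W T = 0"
      "?r W {} + coord_dim V UNIV \<le> ?r V T + coord_dim W UNIV"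
      using Suc by blast
    with True show ?thesis by (intro exI[of _ W]) auto
  next
    case False
    obtain W where W: "W \<in> subspaces n" "W \<subseteq> V" "coord_dim W (T \<union> B (Suc t)) = 0"
      "?r W {} + coord_dim V UNIV \<le> ?r V (T \<union> B (Suc t)) + coord_dim W UNIV"
      using Suc by blast
    have "coord_dim W T = 0" "coord_dim W (B (Suc t)) = 0"
      using W(3) coord_dim_mono[OF fin[OF W(2)], of _ "T \<union> B (Suc t)"]
      by (metis Un_upper1 Un_upper2 le_zero_eq)+
    moreover from this have "?r W (B (Suc t)) \<le> ?r W {}"
      using block_rank_Un_le[OF fin[OF W(2)], of k B t "{}" "B (Suc t)"] by simp
    ultimately show ?thesis using False W by (intro exI[of _ W]) auto
  qed
qed

lemma block_rank_cong:
  assumes "\<And>T. P T \<Longrightarrow> d T = d' T" "\<And>T i. P T \<Longrightarrow> i \<in> {1..t} \<Longrightarrow> P (T \<union> B i)" "P T"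
  shows "block_rank d k B t T = block_rank d' k B t T"
  using assms by (induction t arbitrary: T) auto

lemma coords_vec_first:
  assumes "v \<in> carrier_vec (n1 + n2)" "T \<subseteq> {..<n1}"
  shows "coords T (vec_first v n1) = coords T v"
  using assms by (auto simp: coords_def vec_first_def fun_eq_iff)

text \<open>Shifting the coordinates by \<open>n1\<close>, in either direction, is linear.\<close>

lemma coord_dim_vec_last:
  assumes V: "V \<subseteq> carrier_vec (n1 + n2)" and fin: "finite V"
  shows "coord_dim ((\<lambda>v. vec_last v n2) ` V) UNIV = coord_dim V {n1..<n1 + n2}"
proof (rule antisym)
  let ?l = "\<lambda>f :: nat \<Rightarrow> 'a. \<lambda>j. f (j + n1)"
  let ?r = "\<lambda>f :: nat \<Rightarrow> 'a. \<lambda>j. if n1 \<le> j then f (j - n1) else 0"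
  have l: "?l (coords {n1..<n1 + n2} v) = coords UNIV (vec_last v n2)" if "v \<in> V" for v
    using that V by (force simp: coords_def vec_last_def fun_eq_iff add.commute)
  have r: "?r (coords UNIV (vec_last v n2)) = coords {n1..<n1 + n2} v" if "v \<in> V" for v
    using that V by (force simp: coords_def vec_last_def fun_eq_iff)
  have "coords UNIV ` (\<lambda>v. vec_last v n2) ` V = ?l ` coords {n1..<n1 + n2} ` V"
    unfolding image_image by (intro image_cong refl l[symmetric])
  moreover have "Vector_Spaces.linear fscale fscale ?l"
    by (auto simp: linear_fun_iff fscale_def fun_eq_iff)
  ultimately show "coord_dim ((\<lambda>v. vec_last v n2) ` V) UNIV \<le> coord_dim V {n1..<n1 + n2}"
    using fvp.dim_image_le_finite[of ?l "coords {n1..<n1 + n2} ` V"] fin by simp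
  have "coords {n1..<n1 + n2} ` V = ?r ` coords UNIV ` (\<lambda>v. vec_last v n2) ` V"
    unfolding image_image by (intro image_cong refl r[symmetric])
  moreover have "Vector_Spaces.linear fscale fscale ?r"
    by (auto simp: linear_fun_iff fscale_def fun_eq_iff)
  ultimately show "coord_dim V {n1..<n1 + n2} \<le> coord_dim ((\<lambda>v. vec_last v n2) ` V) UNIV"
    using fvp.dim_image_le_finite[of ?r "coords UNIV ` (\<lambda>v. vec_last v n2) ` V"] fin by simp
qed

lemma subspaces_vec_first:
  assumes "V \<in> subspaces (n1 + n2)"
  shows "(\<lambda>v. vec_first v n1) ` V \<in> subspaces n1"
  unfolding subspaces_iff
proof (intro conjI ballI allI)
  have sub: "V \<subseteq> carrier_vec (n1 + n2)" using assms by (simp add: subspaces_iff)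
  show "(\<lambda>v. vec_first v n1) ` V \<subseteq> carrier_vec n1" by auto
  have "0\<^sub>v n1 = vec_first (0\<^sub>v (n1 + n2)) n1" by (auto simp: vec_first_def)
  then show "0\<^sub>v n1 \<in> (\<lambda>v. vec_first v n1) ` V" using assms unfolding subspaces_iff by blast
  show "a + b \<in> (\<lambda>v. vec_first v n1) ` V"
    if ab: "a \<in> (\<lambda>v. vec_first v n1) ` V" "b \<in> (\<lambda>v. vec_first v n1) ` V" for a b
  proof -
    obtain v w where vw: "v \<in> V" "w \<in> V" "a = vec_first v n1" "b = vec_first w n1" using ab by blast
    then have "v \<in> carrier_vec (n1 + n2)" "w \<in> carrier_vec (n1 + n2)" using sub by auto
    then have "a + b = vec_first (v + w) n1" unfolding vw(3,4) vec_first_def by (intro eq_vecI) auto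
    then show ?thesis using assms vw(1,2) unfolding subspaces_iff by blast
  qed
  show "c \<cdot>\<^sub>v a \<in> (\<lambda>v. vec_first v n1) ` V" if a: "a \<in> (\<lambda>v. vec_first v n1) ` V" for c a
  proof -
    obtain v where v: "v \<in> V" "a = vec_first v n1" using a by blast
    then have "v \<in> carrier_vec (n1 + n2)" using sub by auto
    then have "c \<cdot>\<^sub>v a = vec_first (c \<cdot>\<^sub>v v) n1" unfolding v(2) vec_first_def by (intro eq_vecI) auto
    then show ?thesis using assms v(1) unfolding subspaces_iff by blast
  qed
qed

lemma subspaces_vec_last:
  assumes "V \<in> subspaces (n1 + n2)"
  shows "(\<lambda>v. vec_last v n2) ` V \<in> subspaces n2"
  unfolding subspaces_iff
proof (intro conjI ballI allI)
  have sub: "V \<subseteq> carrier_vec (n1 + n2)" using assms by (simp add: subspaces_iff)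
  show "(\<lambda>v. vec_last v n2) ` V \<subseteq> carrier_vec n2" by auto
  have "0\<^sub>v n2 = vec_last (0\<^sub>v (n1 + n2)) n2" by (auto simp: vec_last_def)
  then show "0\<^sub>v n2 \<in> (\<lambda>v. vec_last v n2) ` V" using assms unfolding subspaces_iff by blast
  show "a + b \<in> (\<lambda>v. vec_last v n2) ` V"
    if ab: "a \<in> (\<lambda>v. vec_last v n2) ` V" "b \<in> (\<lambda>v. vec_last v n2) ` V" for a b
  proof -
    obtain v w where vw: "v \<in> V" "w \<in> V" "a = vec_last v n2" "b = vec_last w n2" using ab by blast
    then have "v \<in> carrier_vec (n1 + n2)" "w \<in> carrier_vec (n1 + n2)" using sub by auto
    then have "a + b = vec_last (v + w) n2" unfolding vw(3,4) vec_last_def by (intro eq_vecI) auto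
    then show ?thesis using assms vw(1,2) unfolding subspaces_iff by blast
  qed
  show "c \<cdot>\<^sub>v a \<in> (\<lambda>v. vec_last v n2) ` V" if a: "a \<in> (\<lambda>v. vec_last v n2) ` V" for c a
  proof -
    obtain v where v: "v \<in> V" "a = vec_last v n2" using a by blast
    then have "v \<in> carrier_vec (n1 + n2)" using sub by auto
    then have "c \<cdot>\<^sub>v a = vec_last (c \<cdot>\<^sub>v v) n2" unfolding v(2) vec_last_def by (intro eq_vecI) auto
    then show ?thesis using assms v(1) unfolding subspaces_iff by blast
  qed
qed

text \<open>For a subspace \<open>W\<close> of \<open>V\<close>, the term in the minimum that defines the direct sum is at least
  \<open>block_rank\<close> minus the dimension of \<open>V\<close>: passing from \<open>W\<close> to \<open>V\<close> increases the rank by at most the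
  increase of the dimension, and freeing the last block costs at most the dimension of the
  projection of \<open>W\<close> to it. Equality holds for \<open>W = V\<close> if the last block contributes \<open>k (Suc t)\<close>,
  and otherwise for the kernel of \<open>block_rank_attained\<close>.\<close>

lemma rank_direct_sum_uniform:
  fixes M :: "'a::{finite,field} qmatroid"
  assumes M: "ground_dim M = n1" "\<And>V. V \<in> subspaces n1 \<Longrightarrow>
      rank_fun M V = int (block_rank (coord_dim V) k B t {})"
    and B: "\<And>i. i \<in> {1..t} \<Longrightarrow> B i \<subseteq> {..<n1}" "B (Suc t) = {n1..<n1 + n2}"
    and V: "V \<in> subspaces (n1 + n2)"
  shows "rank_fun (direct_sum M (uniform_qm (k (Suc t)) n2)) V =
    int (block_rank (coord_dim V) k B (Suc t) {})"
proof -
  let ?k = "k (Suc t)" and ?B = "B (Suc t)"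
  let ?r = "\<lambda>V. block_rank (coord_dim V) k B t"
  let ?\<S> = "{W \<in> subspaces (n1 + n2). W \<subseteq> V}"
  let ?R = "block_rank (coord_dim V) k B (Suc t) {}"
  let ?F = "\<lambda>W. int (?r W {}) + int (min ?k (coord_dim W ?B)) - int (coord_dim W UNIV)"
  have sub: "W \<subseteq> carrier_vec (n1 + n2)" if "W \<in> subspaces (n1 + n2)" for W :: "'a vec set"
    using that by (simp add: subspaces_iff)
  have fin: "finite W" if "W \<in> subspaces (n1 + n2)" for W :: "'a vec set"
    using finite_subset[OF sub[OF that] finite_carrier_vec] .
  have F: "rank_fun M ((\<lambda>v. vec_first v n1) ` W) +
      rank_fun (uniform_qm ?k n2) ((\<lambda>v. vec_last v n2) ` W) - int (vdim (n1 + n2) W) = ?F W"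
    if W: "W \<in> ?\<S>" for W
  proof -
    have Ws: "W \<in> subspaces (n1 + n2)" using W by simp
    have "coords T ` (\<lambda>v. vec_first v n1) ` W = coords T ` W" if "T \<subseteq> {..<n1}" for T
      unfolding image_image using that sub[OF Ws]
      by (intro image_cong refl coords_vec_first[of _ n1 n2]) auto
    then have "block_rank (coord_dim ((\<lambda>v. vec_first v n1) ` W)) k B t {} = ?r W {}"
      using B(1) by (intro block_rank_cong[where P = "\<lambda>T. T \<subseteq> {..<n1}"]) auto
    then have "rank_fun M ((\<lambda>v. vec_first v n1) ` W) = int (?r W {})"
      using M(2) subspaces_vec_first[OF Ws] by simp
    moreover have "rank_fun (uniform_qm ?k n2) ((\<lambda>v. vec_last v n2) ` W) =
        int (min ?k (coord_dim W ?B))"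
      using subspaces_vec_last[OF Ws] vdim_eq_dim_coords[OF subspaces_vec_last[OF Ws]]
        coord_dim_vec_last[OF sub[OF Ws] fin[OF Ws]] B(2)
      by (simp add: uniform_qm_def)
    ultimately show ?thesis using vdim_eq_dim_coords[OF Ws] by simp
  qed
  have "rank_fun (direct_sum M (uniform_qm ?k n2)) V = int (coord_dim V UNIV) + Min (?F ` ?\<S>)"
  proof -
    have "ground_dim (uniform_qm ?k n2 :: 'a qmatroid) = n2" by (simp add: uniform_qm_def)
    then have "rank_fun (direct_sum M (uniform_qm ?k n2)) V = int (vdim (n1 + n2) V) +
      (MIN W\<in>?\<S>. rank_fun M ((\<lambda>v. vec_first v n1) ` W) +
        rank_fun (uniform_qm ?k n2) ((\<lambda>v. vec_last v n2) ` W) - int (vdim (n1 + n2) W))"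
      using M(1) V by (simp add: direct_sum_def Let_def)
    also have "\<dots> = int (vdim (n1 + n2) V) + Min (?F ` ?\<S>)"
      by (intro arg_cong2[where f = "(+)"] arg_cong[where f = Min] image_cong refl F)
    finally show ?thesis using vdim_eq_dim_coords[OF V] by simp
  qed
  moreover have "Min (?F ` ?\<S>) = int ?R - int (coord_dim V UNIV)"
  proof (rule antisym)
    have "?\<S> \<subseteq> Pow V" by blast
    then have finS: "finite ?\<S>" by (rule finite_subset) (simp add: fin[OF V])
    have VS: "V \<in> ?\<S>" using V by simp
    have lower: "int ?R - int (coord_dim V UNIV) \<le> ?F W" if W: "W \<in> ?\<S>" for W
    proof -
      have "?r V T + coord_dim W UNIV \<le> ?r W T + coord_dim V UNIV" for T
        using W by (intro block_rank_diff_mono fin[OF V]) simp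
      from this[of "{}"] this[of ?B]
      show ?thesis using block_rank_Un_le[OF fin, of W k B t "{}" ?B] W by simp
    qed
    show "int ?R - int (coord_dim V UNIV) \<le> Min (?F ` ?\<S>)"
      using finS VS lower by (intro Min.boundedI) auto
    have "\<exists>W\<in>?\<S>. ?F W \<le> int ?R - int (coord_dim V UNIV)"
    proof (cases "?k + ?r V {} \<le> ?r V ?B")
      case True
      then show ?thesis using VS by (intro bexI[of _ V]) auto
    next
      case False
      obtain W where "W \<in> subspaces (n1 + n2)" "W \<subseteq> V" "coord_dim W ?B = 0"
        "?r W {} + coord_dim V UNIV \<le> ?r V ?B + coord_dim W UNIV"
        using block_rank_attained[OF V] by blast
      with False show ?thesis by (intro bexI[of _ W]) auto
    qed
    then show "Min (?F ` ?\<S>) \<le> int ?R - int (coord_dim V UNIV)"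
      using finS by (meson Min_le finite_imageI imageI order_trans)
  qed
  ultimately show ?thesis by simp
qed

definition block :: "(nat \<Rightarrow> nat) \<Rightarrow> nat \<Rightarrow> nat set" where
  "block n i = {\<Sum>l\<in>{1..i - 1}. n l..<\<Sum>l\<in>{1..i}. n l}"

lemma block_subset: "i \<in> {1..t} \<Longrightarrow> block n i \<subseteq> {..<\<Sum>l\<in>{1..t}. n l}"
proof -
  assume "i \<in> {1..t}"
  then have "(\<Sum>l\<in>{1..i}. n l) \<le> (\<Sum>l\<in>{1..t}. n l)" by (intro sum_mono2) auto
  then show ?thesis by (auto simp: block_def)
qed

lemma direct_sums_Suc:
  "t > 0 \<Longrightarrow> direct_sums M (Suc t) = direct_sum (direct_sums M t) (M (Suc t))"
  by (simp add: direct_sums_def)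

lemma direct_sums_uniform:
  fixes k n :: "nat \<Rightarrow> nat"
  defines "M \<equiv> (\<lambda>i. uniform_qm (k i) (n i) :: 'a::{finite,field} qmatroid)"
  assumes "t > 0"
  shows "ground_dim (direct_sums M t) = (\<Sum>l\<in>{1..t}. n l)" (is ?g)
    and "rank_fun (direct_sums M t) \<in> extensional (subspaces (\<Sum>l\<in>{1..t}. n l))" (is ?e)
    and "\<And>V. V \<in> subspaces (\<Sum>l\<in>{1..t}. n l) \<Longrightarrow>
      rank_fun (direct_sums M t) V = int (block_rank (coord_dim V) k (block n) t {})"
proof -
  have "?g \<and> ?e \<and> (\<forall>V\<in>subspaces (\<Sum>l\<in>{1..t}. n l).
      rank_fun (direct_sums M t) V = int (block_rank (coord_dim V) k (block n) t {}))"
    using \<open>t > 0\<close>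
  proof (induction t)
    case (Suc t)
    show ?case
    proof (cases "t = 0")
      case True
      have M: "direct_sums M (Suc 0) = uniform_qm (k 1) (n 1)" by (simp add: direct_sums_def M_def)
      have "min (k 1) (vdim (n 1) V) = block_rank (coord_dim V) k (block n) (Suc 0) {}"
        if V: "V \<in> subspaces (n 1)" for V :: "'a vec set"
      proof -
        have "vdim (n 1) V = coord_dim V (block n 1)"
          using vdim_eq_dim_coords[OF V] coord_dim_UNIV[of V "n 1"] V
          by (simp add: block_def atLeast0LessThan subspaces_iff)
        then show ?thesis by (simp add: coord_dim_empty)
      qed
      then show ?thesis using True M by (simp add: uniform_qm_def extensional_def)
    next
      case False
      let ?N = "\<Sum>l\<in>{1..t}. n l"
      have IH: "ground_dim (direct_sums M t) = ?N"
        "\<And>V. V \<in> subspaces ?N \<Longrightarrow>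
          rank_fun (direct_sums M t) V = int (block_rank (coord_dim V) k (block n) t {})"
        using Suc.IH False by simp_all
      have N: "(\<Sum>l\<in>{1..Suc t}. n l) = ?N + n (Suc t)" by simp
      have M: "direct_sums M (Suc t) = direct_sum (direct_sums M t) (uniform_qm (k (Suc t)) (n (Suc t)))"
        using direct_sums_Suc False by (simp add: M_def)
      have g: "ground_dim (uniform_qm (k (Suc t)) (n (Suc t)) :: 'a qmatroid) = n (Suc t)"
        by (simp add: uniform_qm_def)
      have "ground_dim (direct_sums M (Suc t)) = ?N + n (Suc t)"
        "rank_fun (direct_sums M (Suc t)) \<in> extensional (subspaces (?N + n (Suc t)))"
        unfolding M using IH(1) g by (simp_all add: direct_sum_def Let_def)
      moreover have "rank_fun (direct_sums M (Suc t)) V =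
          int (block_rank (coord_dim V) k (block n) (Suc t) {})"
        if "V \<in> subspaces (?N + n (Suc t))" for V
        unfolding M
      proof (rule rank_direct_sum_uniform[OF IH _ _ that])
        show "block n i \<subseteq> {..<?N}" if "i \<in> {1..t}" for i using block_subset[OF that] .
        show "block n (Suc t) = {?N..<?N + n (Suc t)}" by (simp add: block_def)
      qed
      ultimately show ?thesis unfolding N by blast
    qed
  qed simp
  then show ?g ?e "\<And>V. V \<in> subspaces (\<Sum>l\<in>{1..t}. n l) \<Longrightarrow>
      rank_fun (direct_sums M t) V = int (block_rank (coord_dim V) k (block n) t {})"
    by blast+
qed

section \<open>Finite fields\<close>

text \<open>Multiplication by \<open>x \<noteq> 0\<close> permutes the nonzero elements of \<open>S\<close>; compare their products.\<close>

lemma power_card_eq_same: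
  fixes S :: "'b::field set"
  assumes fin: "finite S" and mult: "\<And>x y. x \<in> S \<Longrightarrow> y \<in> S \<Longrightarrow> x * y \<in> S"
    and zero: "0 \<in> S" and x: "x \<in> S"
  shows "x ^ card S = x"
proof (cases "x = 0")
  case True
  have "card S > 0" using fin zero card_gt_0_iff by blast
  then show ?thesis using True by simp
next
  case False
  let ?S = "S - {0}"
  have "(*) x ` ?S = ?S"
  proof (rule endo_inj_surj)
    show "(*) x ` ?S \<subseteq> ?S" using mult x False by auto
    show "inj_on ((*) x) ?S" using False by (auto simp: inj_on_def)
  qed (use fin in simp)
  then have "prod id ?S = prod id ((*) x ` ?S)" by simp
  also have "\<dots> = (\<Prod>y\<in>?S. x * y)" using False by (subst prod.reindex) (auto simp: inj_on_def)
  also have "\<dots> = x ^ card ?S * prod id ?S" by (simp add: prod.distrib)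
  finally have "x ^ card ?S = 1" using fin by simp
  moreover have "card S = Suc (card ?S)" using fin zero by (metis card_Suc_Diff1)
  ultimately show ?thesis by simp
qed

text \<open>By Sylow's theorem the additive group contains a nonzero element that is annihilated by \<open>r\<close>.\<close>

lemma prime_divisor_of_card_eq_CHAR:
  assumes r: "Factorial_Ring.prime (r :: nat)" "r dvd CARD('a::{finite,field})"
  shows "r = CHAR('a)"
proof -
  let ?G = "\<lparr>carrier = UNIV, monoid.mult = (+), one = 0\<rparr> :: 'a monoid"
  interpret G: comm_group ?G
    by (rule comm_groupI) (auto simp: add.assoc add.commute intro: exI[of _ "- _"])
  obtain m where m: "CARD('a) = r ^ 1 * m" using r(2) by auto
  have "Coset.order ?G = r ^ 1 * m" using m by (simp add: Coset.order_def)
  then obtain H where H: "subgroup H ?G" "card H = r ^ 1"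
    using sylow_thm[OF r(1) G.is_group, of 1 m] by auto
  have "H \<noteq> {0}" using H(2) r(1) by auto
  moreover have "0 \<in> H" using subgroup.one_closed[OF H(1)] by simp
  ultimately obtain x where x: "x \<in> H" "x \<noteq> 0" by blast
  interpret H: group "?G\<lparr>carrier := H\<rparr>" using subgroup.subgroup_is_group[OF H(1) G.is_group] .
  have pow: "x [^]\<^bsub>?G\<lparr>carrier := H\<rparr>\<^esub> l = of_nat l * x" for l :: nat
    by (induction l) (auto simp: algebra_simps nat_pow_def)
  have "x [^]\<^bsub>?G\<lparr>carrier := H\<rparr>\<^esub> card H = 0"
    using H.pow_order_eq_1[of x] x(1) by (simp add: Coset.order_def)
  then have "of_nat r = (0 :: 'a)" using x(2) H(2) pow[of r] by simp
  then have "CHAR('a) dvd r" using of_nat_eq_0_iff_char_dvd by blast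
  then show ?thesis using r(1) CHAR_not_1'[where ?'a = 'a] by (metis One_nat_def prime_nat_iff)
qed

lemma card_finite_field_is_CHAR_power: "\<exists>e. CARD('a::{finite,field}) = CHAR('a) ^ e"
proof -
  have "\<exists>e. d = CHAR('a) ^ e" if "d dvd CARD('a)" for d :: nat
    using that
  proof (induction d rule: less_induct)
    case (less d)
    have d0: "d > 0" using less.prems by (metis dvd_pos_nat finite_UNIV_card_ge_0 finite)
    show ?case
    proof (cases "d = 1")
      case True
      then show ?thesis by (intro exI[of _ 0]) simp
    next
      case False
      then obtain r where r: "Factorial_Ring.prime r" "r dvd d" using prime_factor_nat by blast
      then have rC: "r = CHAR('a)" using prime_divisor_of_card_eq_CHAR less.prems dvd_trans by blast
      obtain d' where d': "d = r * d'" using r(2) by blast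
      have "d' < d" using d' d0 prime_gt_1_nat[OF r(1)] by simp
      moreover have "d' dvd CARD('a)" using less.prems d' dvd_mult_right by blast
      ultimately obtain e where "d' = CHAR('a) ^ e" using less.IH by blast
      then show ?thesis using d' rC by (intro exI[of _ "Suc e"]) simp
    qed
  qed
  then show ?thesis by simp
qed

lemma CHAR_field_hom:
  assumes "field_hom (h :: 'a::field \<Rightarrow> 'b::field)"
  shows "CHAR('b) = CHAR('a)"
proof -
  interpret h: field_hom h by fact
  have nat: "h (of_nat l) = of_nat l" for l by (induction l) (simp_all add: h.hom_add)
  have "of_nat l = (0 :: 'b) \<longleftrightarrow> of_nat l = (0 :: 'a)" for l
    using h.hom_0_iff[of "of_nat l"] nat[of l] by simp
  then show ?thesis unfolding of_nat_eq_0_iff_char_dvd by (metis dvd_antisym dvd_refl)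
qed

text \<open>Since \<open>CARD('a)\<close> is a power of the characteristic, its powers give Frobenius endomorphisms.\<close>

lemma frobenius_field_hom:
  assumes h: "field_hom (h :: 'a::{finite,field} \<Rightarrow> 'b::field)"
  shows "field_hom (\<lambda>x :: 'b. x ^ (CARD('a) ^ a))"
proof -
  have "CHAR('a) > 0" by (rule finite_imp_CHAR_pos) simp
  then have "Factorial_Ring.prime CHAR('a)" by (rule prime_CHAR_semidom)
  then have pr: "Factorial_Ring.prime CHAR('b)" by (simp add: CHAR_field_hom[OF h])
  obtain e where "CARD('a) = CHAR('b) ^ e"
    using card_finite_field_is_CHAR_power[where ?'a = 'a] CHAR_field_hom[OF h] by auto
  then have e: "CARD('a) ^ a = CHAR('b) ^ (e * a)" by (simp add: power_mult)
  show ?thesis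
    by unfold_locales (simp_all add: power_mult_distrib freshmans_dream'[OF pr e])
qed

definition fixed_field :: "nat \<Rightarrow> 'b::field set" where
  "fixed_field Q = {x. x ^ Q = x}"

lemma field_hom_image_in_fixed_field:
  assumes "field_hom (h :: 'a::{finite,field} \<Rightarrow> 'b::field)"
  shows "h x \<in> fixed_field (CARD('a) ^ a)"
proof -
  interpret h: field_hom h by fact
  have "x ^ CARD('a) = x" by (rule power_card_eq_same) simp_all
  then have "x ^ (CARD('a) ^ a) = x" by (induction a) (simp_all add: power_mult)
  then show ?thesis unfolding fixed_field_def by (metis (mono_tags) h.hom_power mem_Collect_eq)
qed

lemma fixed_field_power: "x \<in> fixed_field Q \<Longrightarrow> x \<in> fixed_field (Q ^ r)"
  unfolding fixed_field_def by (induction r) (simp_all add: power_mult)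

lemma power_in_fixed_field: "x \<in> fixed_field Q \<Longrightarrow> x ^ l \<in> fixed_field Q"
  unfolding fixed_field_def by (metis (mono_tags) mem_Collect_eq mult.commute power_mult)

definition frob_poly :: "nat \<Rightarrow> 'b::field poly" where
  "frob_poly Q = [:0, 1:] ^ Q - [:0, 1:]"

lemma poly_frob_poly: "poly (frob_poly Q) x = x ^ Q - x"
  by (simp add: frob_poly_def)

lemma degree_frob_poly:
  assumes "Q > 1"
  shows "Polynomial.degree (frob_poly Q :: 'b::field poly) = Q"
proof -
  have "Polynomial.degree ([:0, 1:] ^ Q + - [:0, 1:] :: 'b poly) = Polynomial.degree ([:0, 1:] ^ Q :: 'b poly)"
    using assms by (intro degree_add_eq_left) (simp add: degree_linear_power)
  then show ?thesis
    unfolding frob_poly_def diff_conv_add_uminus by (simp add: degree_linear_power)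
qed

lemma fixed_field_eq_roots: "fixed_field Q = {x. poly (frob_poly Q) x = 0}"
  by (simp add: fixed_field_def poly_frob_poly)

lemma
  assumes "Q > 1"
  shows finite_fixed_field: "finite (fixed_field Q :: 'b::field set)"
    and card_fixed_field_le: "card (fixed_field Q :: 'b::field set) \<le> Q"
proof -
  have "frob_poly Q \<noteq> (0 :: 'b poly)" using degree_frob_poly[OF assms, where ?'b = 'b] assms by auto
  then show "finite (fixed_field Q :: 'b set)" "card (fixed_field Q :: 'b set) \<le> Q"
    unfolding fixed_field_eq_roots
    using poly_roots_finite[of "frob_poly Q :: 'b poly"] card_poly_roots_bound[of "frob_poly Q :: 'b poly"]
    by (simp_all add: degree_frob_poly[OF assms])
qed

lemma frob_poly_dvd: "frob_poly Q dvd (frob_poly (Q ^ r) :: 'b::field poly)"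
proof (induction r)
  case 0
  show ?case by (simp add: frob_poly_def)
next
  case (Suc r)
  let ?X = "[:0, 1:] :: 'b poly"
  have "?X ^ (Q ^ r) - ?X dvd (?X ^ (Q ^ r)) ^ Q - ?X ^ Q"
    by (simp add: power_diff_sumr2)
  then have "frob_poly Q dvd (?X ^ (Q ^ r)) ^ Q - ?X ^ Q"
    using Suc dvd_trans unfolding frob_poly_def by blast
  then have "frob_poly Q dvd ((?X ^ (Q ^ r)) ^ Q - ?X ^ Q) + (?X ^ Q - ?X)"
    by (rule dvd_add) (simp add: frob_poly_def)
  moreover have "((?X ^ (Q ^ r)) ^ Q - ?X ^ Q) + (?X ^ Q - ?X) = frob_poly (Q ^ Suc r)"
    by (simp add: frob_poly_def power_mult[symmetric] mult.commute)
  ultimately show ?case by simp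
qed

text \<open>The polynomial \<open>x ^ (Q ^ r) - x\<close> is a multiple of \<open>x ^ Q - x\<close>. If the former has as many
  roots as its degree, then so has the latter, as the cofactor has at most \<open>Q ^ r - Q\<close> roots.\<close>

lemma card_fixed_subfield:
  assumes Q: "Q > 1" and r: "r > 0" and card: "card (fixed_field (Q ^ r) :: 'b::field set) = Q ^ r"
  shows "card (fixed_field Q :: 'b set) = Q"
proof (rule antisym[OF card_fixed_field_le[OF Q]])
  obtain g where g: "frob_poly (Q ^ r) = frob_poly Q * (g :: 'b poly)" using frob_poly_dvd by blast
  have Qr: "Q ^ r > 1" by (rule one_less_power[OF Q r])
  have nz: "frob_poly (Q ^ r) \<noteq> (0 :: 'b poly)"
    using degree_frob_poly[OF Qr, where ?'b = 'b] Qr by (metis degree_0 not_one_less_zero)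
  then have gnz: "g \<noteq> 0" "frob_poly Q \<noteq> (0 :: 'b poly)" using g by auto
  have "Q ^ r = Q + Polynomial.degree g"
    using degree_mult_eq[OF gnz(2,1)] g degree_frob_poly[OF Q, where ?'b = 'b]
      degree_frob_poly[OF Qr, where ?'b = 'b] by simp
  moreover have "fixed_field (Q ^ r) = fixed_field Q \<union> {x. poly g x = 0}"
    unfolding fixed_field_eq_roots g by auto
  then have "Q ^ r \<le> card (fixed_field Q :: 'b set) + card {x. poly g x = 0}"
    using card card_Un_le by metis
  ultimately show "Q \<le> card (fixed_field Q :: 'b set)"
    using card_poly_roots_bound[OF gnz(1)] by linarith
qed

text \<open>The polynomial \<open>x ^ Q - x\<close> is separable, because its derivative is \<open>-1\<close>.\<close>

lemma card_fixed_field_alg_closed: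
  assumes Q: "Q > 1" and char: "of_nat Q = (0 :: 'b::alg_closed_field)"
  shows "card (fixed_field Q :: 'b set) = Q"
proof -
  let ?p = "frob_poly Q :: 'b poly"
  have nz: "?p \<noteq> 0" using degree_frob_poly[OF Q, where ?'b = 'b] Q by auto
  obtain A where A: "size A = Polynomial.degree ?p"
      "?p = smult (Polynomial.lead_coeff ?p) (\<Prod>x\<in>#A. [:- x, 1:])"
    using alg_closed_imp_factorization[OF nz] by blast
  have deriv: "poly (pderiv ?p) x = -1" for x
    using char by (simp add: frob_poly_def pderiv_diff pderiv_power pderiv_pCons)
  have "count A x \<le> 1" for x
  proof (rule ccontr)
    assume "\<not> count A x \<le> 1"
    then have "{#x, x#} \<subseteq># A" by (auto simp: subseteq_mset_def)
    then obtain C where C: "A = {#x, x#} + C" by (auto simp: mset_subset_eq_exists_conv)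
    define s where "s = smult (Polynomial.lead_coeff ?p) (\<Prod>y\<in>#C. [:- y, 1:])"
    have "?p = [:- x, 1:] * ([:- x, 1:] * s)" using A(2) by (simp add: C s_def)
    then have "pderiv ?p = [:- x, 1:] * pderiv ([:- x, 1:] * s) + ([:- x, 1:] * s) * pderiv [:- x, 1:]"
      by (metis pderiv_mult)
    then have "poly (pderiv ?p) x = 0" by simp
    then show False using deriv by simp
  qed
  then have "count A x = count (mset_set (set_mset A)) x" for x
    by (metis One_nat_def count_mset_set(1,3) finite_set_mset le_SucE le_zero_eq not_in_iff)
  then have "A = mset_set (set_mset A)" by (rule multiset_eqI)
  then have "card (set_mset A) = Q"
    using A(1) degree_frob_poly[OF Q, where ?'b = 'b] by (metis size_mset_set)
  moreover have "set_mset A = fixed_field Q"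
    unfolding fixed_field_eq_roots using nz by (subst A(2)) (auto simp: poly_prod_mset image_iff)
  ultimately show ?thesis by simp
qed

lemma subfield_eq_fixed_field:
  fixes K :: "'b::field set"
  assumes K: "subfield K class_ring" and card: "card K = Q" and Q: "Q > 1"
  shows "K = fixed_field Q"
proof (rule card_seteq[OF finite_fixed_field[OF Q]])
  note sub = subringE[OF subfieldE(1)[OF K]]
  have fin: "finite K" using card Q by (intro card_ge_0_finite) simp
  show "K \<subseteq> fixed_field Q"
    unfolding fixed_field_def card[symmetric]
    using power_card_eq_same[OF fin] sub(2,6) by auto
  show "card (fixed_field Q :: 'b set) \<le> card K" using card card_fixed_field_le[OF Q] by simp
qed

lemma subfield_fixed_field:
  assumes "field_hom (\<lambda>x :: 'b::field. x ^ Q)"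
  shows "subfield (fixed_field Q :: 'b set) class_ring"
proof -
  have R: "ring (class_ring :: 'b ring)"
    using class_field unfolding field_def domain_def cring_def by blast
  interpret f: field_hom "\<lambda>x :: 'b. x ^ Q" by fact
  have "subring (fixed_field Q :: 'b set) class_ring"
    by (rule ring.subringI[OF R])
      (auto simp: class_ring_simps fixed_field_def f.hom_add f.hom_mult f.hom_uminus)
  moreover have "inv\<^bsub>class_ring\<^esub> x \<in> fixed_field Q" if "x \<in> fixed_field Q - {\<zero>\<^bsub>class_ring\<^esub>}" for x :: 'b
    using that by (simp add: class_ring_simps fixed_field_def power_inverse)
  ultimately show ?thesis by (rule field.subfieldI'[OF class_field])
qed

text \<open>Greedy choice: fewer than \<open>m\<close> elements span a set of fewer than \<open>Q ^ m\<close> elements over the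
  fixed field of order \<open>Q\<close>, so a further independent element exists.\<close>

lemma independent_family_over_fixed_field:
  fixes Q m :: nat and J :: "'j set"
  assumes \<sigma>: "field_hom (\<lambda>x :: 'b::field. x ^ Q)" and Q: "Q > 1"
    and card: "card (fixed_field (Q ^ m) :: 'b set) = Q ^ m"
    and J: "finite J" "card J \<le> m"
  shows "\<exists>\<alpha>. (\<forall>j\<in>J. \<alpha> j \<in> fixed_field (Q ^ m)) \<and> indep_over_fixed (\<lambda>x :: 'b. x ^ Q) \<alpha> J"
  using J
proof (induction J rule: finite_induct)
  case empty
  show ?case by (simp add: indep_over_fixed_def)
next
  case (insert n J)
  interpret \<sigma>: field_hom "\<lambda>x :: 'b. x ^ Q" by fact
  let ?F = "fixed_field Q :: 'b set"
  obtain \<alpha> where \<alpha>: "\<forall>j\<in>J. \<alpha> j \<in> fixed_field (Q ^ m)" "indep_over_fixed (\<lambda>x :: 'b. x ^ Q) \<alpha> J"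
    using insert by auto
  let ?S = "(\<lambda>c. \<Sum>j\<in>J. c j * \<alpha> j) ` (J \<rightarrow>\<^sub>E ?F)"
  have finP: "finite (J \<rightarrow>\<^sub>E ?F)" by (rule finite_PiE) (simp_all add: insert.hyps(1) finite_fixed_field[OF Q])
  have "card ?S \<le> card (J \<rightarrow>\<^sub>E ?F)" using finP by (rule card_image_le)
  also have "\<dots> = card ?F ^ card J" using insert.hyps(1) by (simp add: card_PiE)
  also have "\<dots> \<le> Q ^ card J" using card_fixed_field_le[OF Q] by (intro power_mono) auto
  also have "\<dots> < Q ^ m" using insert Q by (intro power_strict_increasing) auto
  finally have "card ?S < card (fixed_field (Q ^ m) :: 'b set)" using card by simp
  then have "\<not> fixed_field (Q ^ m) \<subseteq> ?S" using finP by (meson card_mono finite_imageI not_less)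
  then obtain x where x: "x \<in> fixed_field (Q ^ m)" "x \<notin> ?S" by blast
  let ?\<alpha> = "\<alpha>(n := x)"
  have "indep_over_fixed (\<lambda>x :: 'b. x ^ Q) ?\<alpha> (insert n J)"
    unfolding indep_over_fixed_def
  proof (intro allI impI)
    fix c :: "'j \<Rightarrow> 'b"
    assume c: "\<forall>j\<in>insert n J. c j ^ Q = c j" and s: "(\<Sum>j\<in>insert n J. c j * ?\<alpha> j) = 0"
    have "(\<Sum>j\<in>J. c j * ?\<alpha> j) = (\<Sum>j\<in>J. c j * \<alpha> j)"
      using insert.hyps(2) by (intro sum.cong) auto
    then have s': "c n * x + (\<Sum>j\<in>J. c j * \<alpha> j) = 0" using s insert.hyps by simp
    have "c n = 0"
    proof (rule ccontr)
      assume cn: "c n \<noteq> 0"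
      let ?c = "restrict (\<lambda>j. - (c j / c n)) J"
      have "?c \<in> J \<rightarrow>\<^sub>E ?F"
        using c by (auto simp: fixed_field_def \<sigma>.hom_uminus \<sigma>.hom_div)
      moreover have "x = (\<Sum>j\<in>J. ?c j * \<alpha> j)"
      proof -
        have "c n * x = c n * (\<Sum>j\<in>J. ?c j * \<alpha> j)"
          using s' cn by (simp add: sum_distrib_left sum_negf eq_neg_iff_add_eq_0)
        then show ?thesis using cn by simp
      qed
      ultimately show False using x(2) by blast
    qed
    moreover have "\<forall>j\<in>J. c j = 0"
      using \<alpha>(2) c s' \<open>c n = 0\<close> unfolding indep_over_fixed_def by simp
    ultimately show "\<forall>j\<in>insert n J. c j = 0" by simp
  qed
  moreover have "\<forall>j\<in>insert n J. ?\<alpha> j \<in> fixed_field (Q ^ m)" using \<alpha>(1) x(1) by simp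
  ultimately show ?case by blast
qed

section \<open>Representing the direct sum\<close>

lemma indep_over_fixed_cong:
  "(\<And>j. j \<in> J \<Longrightarrow> \<alpha> j = \<beta> j) \<Longrightarrow> indep_over_fixed \<sigma> \<alpha> J = indep_over_fixed \<sigma> \<beta> J"
  by (simp add: indep_over_fixed_def)

lemma block_rank_finite_cong:
  assumes "\<And>T. finite T \<Longrightarrow> d T = d' T" "\<And>i. finite (B i)" "finite T"
  shows "block_rank d k B t T = block_rank d' k B t T"
  using assms by (intro block_rank_cong[where P = finite]) auto

lemma block_unique:
  assumes "j \<in> block n i" "j \<in> block n i'" "i \<ge> 1" "i' \<ge> 1"
  shows "i = i'"
proof -
  have le: "a \<ge> b" if ab: "j \<in> block n a" "j \<in> block n b" "b \<ge> 1" for a b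
  proof (rule ccontr)
    assume "\<not> a \<ge> b"
    then have "(\<Sum>l\<in>{1..a}. n l) \<le> (\<Sum>l\<in>{1..b - 1}. n l)"
      by (intro sum_mono2) auto
    then show False using ab by (auto simp: block_def)
  qed
  show ?thesis using le[of i i'] le[of i' i] assms by simp
qed

lemma card_block: "i \<ge> 1 \<Longrightarrow> card (block n i) = n i"
proof -
  assume "i \<ge> 1"
  then obtain i' where "i = Suc i'" by (cases i) auto
  then show ?thesis by (simp add: block_def)
qed

definition row_indices :: "(nat \<Rightarrow> nat) \<Rightarrow> nat \<Rightarrow> (nat \<times> nat) list" where
  "row_indices k t = concat (map (\<lambda>i. map (Pair i) [0..<k i]) [1..<Suc t])"

lemma set_row_indices: "set (row_indices k t) = (SIGMA i:{1..t}. {..<k i})"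
  by (auto simp: row_indices_def)

text \<open>The block diagonal matrix whose block \<open>i\<close> is the Moore matrix with entries \<open>\<alpha> j ^ (Q i ^ l)\<close>.\<close>

definition block_moore_mat :: "(nat \<Rightarrow> 'b::field) \<Rightarrow> (nat \<Rightarrow> nat) \<Rightarrow> (nat \<Rightarrow> nat) \<Rightarrow> (nat \<Rightarrow> nat) \<Rightarrow> nat
    \<Rightarrow> 'b mat" where
  "block_moore_mat \<alpha> Q k n t =
    mat (length (row_indices k t)) (\<Sum>l\<in>{1..t}. n l)
      (\<lambda>(r, j). case row_indices k t ! r of (i, l) \<Rightarrow> if j \<in> block n i then \<alpha> j ^ (Q i ^ l) else 0)"

lemma mat_image_block_moore_mat:
  fixes h :: "'a::field \<Rightarrow> 'b::field"
  assumes v: "v \<in> carrier_vec (\<Sum>l\<in>{1..t}. n l)"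
    and r: "r < length (row_indices k t)" "row_indices k t ! r = (i, l)"
    and frob: "field_hom (\<lambda>x :: 'b. x ^ Q i)" and fixed: "\<And>a. h a ^ Q i = h a"
  shows "mat_image h (block_moore_mat \<alpha> Q k n t) v r =
    block_row \<alpha> (\<lambda>j v. h (coords UNIV v j)) (block n) Q i l v"
proof -
  let ?N = "\<Sum>l\<in>{1..t}. n l"
  interpret f: field_hom "\<lambda>x :: 'b. x ^ Q i" by fact
  have pow_sum: "(\<Sum>j\<in>J. g j) ^ (Q i ^ l) = (\<Sum>j\<in>J. g j ^ (Q i ^ l))" for J and g :: "nat \<Rightarrow> 'b"
    by (induction l) (simp_all add: power_mult f.hom_sum mult.commute[of "Q i"] del: power_mult_distrib)
  have pow_h: "h a ^ (Q i ^ l) = h a" for a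
    by (induction l) (simp_all add: power_mult fixed)
  have "(i, l) \<in> set (row_indices k t)" using r by (metis nth_mem)
  then have "block n i \<subseteq> {..<?N}" using block_subset by (simp add: set_row_indices)
  then have inter: "{..<?N} \<inter> block n i = block n i" by blast
  have "mat_image h (block_moore_mat \<alpha> Q k n t) v r =
      (\<Sum>j<?N. (if j \<in> block n i then \<alpha> j ^ (Q i ^ l) else 0) * h (coords UNIV v j))"
    using v r by (subst mat_image_eq_mat_fun) (auto simp: mat_fun_def block_moore_mat_def)
  also have "\<dots> = (\<Sum>j<?N. if j \<in> block n i then \<alpha> j ^ (Q i ^ l) * h (coords UNIV v j) else 0)"
    by (intro sum.cong) auto
  also have "\<dots> = (\<Sum>j\<in>block n i. \<alpha> j ^ (Q i ^ l) * h (coords UNIV v j))"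
    by (simp only: sum.inter_restrict[OF finite_lessThan, symmetric] inter)
  also have "\<dots> = (\<Sum>j\<in>block n i. \<alpha> j * h (coords UNIV v j)) ^ (Q i ^ l)"
    by (simp add: pow_sum power_mult_distrib pow_h)
  finally show ?thesis by (simp add: block_row_def)
qed

text \<open>Both matroids have the rank function given by \<open>block_rank\<close>: for the matrix this is
  \<open>dim_block_rows\<close> applied to the restrictions of rows and coordinates to the subspace \<open>U\<close>,
  followed by a change of the field from \<open>'b\<close> to \<open>'a\<close>.\<close>

lemma matrix_qm_block_moore_mat:
  fixes h :: "'a::{finite,field} \<Rightarrow> 'b::field" and k n :: "nat \<Rightarrow> nat"
  assumes h: "field_hom h" and t: "t > 0"
    and frob: "\<And>i. i \<in> {1..t} \<Longrightarrow> field_hom (\<lambda>x :: 'b. x ^ Q i)"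
    and fixed: "\<And>i a. i \<in> {1..t} \<Longrightarrow> h a ^ Q i = h a"
    and \<alpha>fix: "\<And>i i' j. 1 \<le> i' \<Longrightarrow> i' < i \<Longrightarrow> i \<le> t \<Longrightarrow> j \<in> block n i' \<Longrightarrow> \<alpha> j ^ Q i = \<alpha> j"
    and indep: "\<And>i. i \<in> {1..t} \<Longrightarrow> indep_over_fixed (\<lambda>x. x ^ Q i) \<alpha> (block n i)"
  shows "matrix_qm h (block_moore_mat \<alpha> Q k n t) =
    direct_sums (\<lambda>i. uniform_qm (k i) (n i)) t"
proof -
  interpret h: field_hom h by fact
  let ?N = "\<Sum>l\<in>{1..t}. n l"
  let ?G = "block_moore_mat \<alpha> Q k n t"
  let ?M = "direct_sums (\<lambda>i. uniform_qm (k i) (n i)) t :: 'a qmatroid"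
  let ?L = "{..<length (row_indices k t)}"
  note M = direct_sums_uniform[OF t, where k = k and n = n and ?'a = 'a]
  have dim: "dim_col ?G = ?N" "dim_row ?G = length (row_indices k t)"
    by (simp_all add: block_moore_mat_def)
  have rank: "fvs.dim (mat_image h ?G ` U) = block_rank (coord_dim U) k (block n) t {}"
    if U: "U \<in> subspaces ?N" for U
  proof -
    have sub: "U \<subseteq> carrier_vec ?N" using U by (simp add: subspaces_iff)
    have fin: "finite U" using finite_subset[OF sub finite_carrier_vec] .
    define c where "c = (\<lambda>j v. if v \<in> U then h (coords UNIV v j) else 0)"
    have row: "(\<lambda>v. if v \<in> U then mat_image h ?G v r else 0) = block_row \<alpha> c (block n) Q i l"
      if r: "r < length (row_indices k t)" "row_indices k t ! r = (i, l)" for r i l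
    proof
      fix v
      have i: "i \<in> {1..t}" using r set_row_indices[of k t] nth_mem by fastforce
      interpret f: field_hom "\<lambda>x :: 'b. x ^ Q i" using frob[OF i] .
      have "Q i > 0" using f.hom_zero by (metis gr0I power_0 zero_neq_one)
      then show "(if v \<in> U then mat_image h ?G v r else 0) = block_row \<alpha> c (block n) Q i l v"
        using mat_image_block_moore_mat[of v n t r k i l Q h \<alpha>] sub r frob[OF i] fixed[OF i]
        by (auto simp: block_row_def c_def)
    qed
    have rows: "(\<lambda>r v. if v \<in> U then mat_image h ?G v r else 0) ` ?L =
        (\<Union>i\<in>{1..t}. block_row \<alpha> c (block n) Q i ` {..<k i})"
    proof -
      have "(\<lambda>r v. if v \<in> U then mat_image h ?G v r else 0) ` ?L =
          (\<lambda>(i, l). block_row \<alpha> c (block n) Q i l) ` (!) (row_indices k t) ` ?L"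
        unfolding image_image by (intro image_cong) (auto simp: row split: prod.split)
      also have "(!) (row_indices k t) ` ?L = set (row_indices k t)"
        by (auto simp: set_conv_nth)
      finally show ?thesis by (auto simp: set_row_indices)
    qed
    have "fvs.dim (mat_image h ?G ` U) =
        fvs.dim ((\<Union>i\<in>{1..t}. block_row \<alpha> c (block n) Q i ` {..<k i}) \<union> c ` {})"
      using dim_image_eq_dim_rows[OF fin, of ?L "mat_image h ?G"] dim(2)
      unfolding rows[symmetric] by (simp add: mat_image_def coords_def)
    also have "\<dots> = block_rank (\<lambda>T. fvs.dim (c ` T)) k (block n) t {}"
    proof (rule dim_block_rows[OF frob _ \<alpha>fix indep])
      show "c j v ^ Q i = c j v" if "i \<in> {1..t}" for i j v
      proof -
        interpret f: field_hom "\<lambda>x :: 'b. x ^ Q i" using frob[OF that] .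
        show ?thesis using fixed[OF that] f.hom_zero by (simp add: c_def)
      qed
    qed (simp_all add: block_def)
    also have "\<dots> = block_rank (coord_dim U) k (block n) t {}"
    proof (rule block_rank_finite_cong)
      fix T :: "nat set" assume T: "finite T"
      have "coord_dim U T = fvs.dim ((\<circ>) h ` coords T ` U)"
        using dim_of_extension[OF h, of "coords T ` U"] fin by simp
      also have "\<dots> = fvs.dim ((\<lambda>v. h \<circ> coords T v) ` U)" by (simp add: image_image)
      also have "\<dots> = fvs.dim ((\<lambda>i v. if v \<in> U then (h \<circ> coords T v) i else 0) ` T)"
        using fin T by (rule dim_image_eq_dim_rows) (simp add: coords_def)
      also have "(\<lambda>i v. if v \<in> U then (h \<circ> coords T v) i else 0) ` T = c ` T"
        by (intro image_cong) (auto simp: c_def coords_def fun_eq_iff)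
      finally show "fvs.dim (c ` T) = coord_dim U T" by simp
    qed (simp_all add: block_def)
    finally show ?thesis .
  qed
  show ?thesis
  proof (rule qmatroid.expand, intro conjI)
    show "ground_dim (matrix_qm h ?G) = ground_dim ?M" using M(1) dim by (simp add: matrix_qm_def)
    show "rank_fun (matrix_qm h ?G) = rank_fun ?M"
    proof (rule extensionalityI[OF _ M(2)])
      show "rank_fun (matrix_qm h ?G) \<in> extensional (subspaces ?N)"
        using dim by (simp add: matrix_qm_def)
      fix U :: "'a vec set" assume U: "U \<in> subspaces ?N"
      then have "rank_fun (matrix_qm h ?G) U =
          int (vec_space.rank (dim_row ?G) (?G * map_mat h (basis_mat (dim_col ?G) U)))"
        using dim(1) by (simp add: matrix_qm_def)
      also have "\<dots> = int (fvs.dim (mat_image h ?G ` U))"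
        using rank_on_subspace[OF h, of U ?G] U dim(1) by simp
      finally show "rank_fun (matrix_qm h ?G) U = rank_fun ?M U" using M(3)[OF U] rank[OF U] by simp
    qed
  qed
qed

text \<open>The field has the chain of subfields of orders \<open>Q 1 = q\<close>, \<open>Q 2 = q ^ m 1\<close>, \<open>Q 3 = q ^ (m 1 * m 2)\<close>
  and so on. Block \<open>i\<close> uses the Frobenius power \<open>x ^ Q i\<close> and elements \<open>\<alpha> j\<close> of the field of order
  \<open>Q (i + 1)\<close> that are independent over the field of order \<open>Q i\<close>; there are \<open>n i \<le> m i\<close> of them.\<close>

lemma representable_over_tower:
  fixes h :: "'a::{finite,field} \<Rightarrow> 'b::field" and k n m :: "nat \<Rightarrow> nat"
  assumes h: "field_hom h" and t: "t > 0"
    and m: "\<And>i. i \<in> {1..t} \<Longrightarrow> 0 < m i \<and> n i \<le> m i"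
    and card: "card (fixed_field (CARD('a) ^ (\<Prod>i\<in>{1..t}. m i)) :: 'b set) =
      CARD('a) ^ (\<Prod>i\<in>{1..t}. m i)"
  shows "representable_over h (fixed_field (CARD('a) ^ (\<Prod>i\<in>{1..t}. m i)))
    (direct_sums (\<lambda>i. uniform_qm (k i) (n i)) t)"
proof -
  \<comment> \<open>The index is chosen so that \<open>Q i\<close> is the order of the field over which block \<open>i\<close> is built,
      and \<open>Q (Suc i)\<close> that of the field containing its entries.\<close>
  define e where "e = (\<lambda>i. \<Prod>l\<in>{1..i - 1}. m l)"
  define Q where "Q = (\<lambda>i. CARD('a) ^ e i)"
  let ?K = "fixed_field (CARD('a) ^ (\<Prod>i\<in>{1..t}. m i)) :: 'b set"
  have "card {0, 1 :: 'a} \<le> CARD('a)" by (intro card_mono) auto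
  then have q: "CARD('a) > 1" by simp
  have epos: "e i > 0" if "i \<le> Suc t" for i
    unfolding e_def using m that by (intro prod_pos) auto
  have Q1: "Q i > 1" if "i \<le> Suc t" for i unfolding Q_def by (rule one_less_power[OF q epos[OF that]])
  have frob: "field_hom (\<lambda>x :: 'b. x ^ Q i)" for i unfolding Q_def by (rule frobenius_field_hom[OF h])
  have Q_Suc: "Q (Suc i) = Q i ^ m i" if "i \<ge> 1" for i
  proof -
    have "{1..i} = insert i {1..i - 1}" using that by auto
    then have "e (Suc i) = m i * e i" using that by (simp add: e_def)
    then show ?thesis by (simp add: Q_def power_mult[symmetric] mult.commute)
  qed
  have Q_mono: "\<exists>r>0. Q i' = Q i ^ r" if ii': "1 \<le> i" "i \<le> i'" "i' \<le> Suc t" for i i'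
    using ii'(2,3)
  proof (induction i' rule: dec_induct)
    case base
    show ?case by (intro exI[of _ 1]) simp
  next
    case (step i')
    then obtain r where "r > 0" "Q i' = Q i ^ r" by auto
    then show ?case
      using Q_Suc[of i'] m[of i'] step ii'(1) by (intro exI[of _ "r * m i'"]) (auto simp: power_mult)
  qed
  have Qt: "Q (Suc t) = CARD('a) ^ (\<Prod>i\<in>{1..t}. m i)" by (simp add: Q_def e_def)
  have cardQ: "card (fixed_field (Q i) :: 'b set) = Q i" if i: "1 \<le> i" "i \<le> Suc t" for i
  proof -
    obtain r where r: "r > 0" "Q (Suc t) = Q i ^ r" using Q_mono[OF i] by auto
    show ?thesis
      using card_fixed_subfield[OF Q1[OF i(2)] r(1)] card unfolding r(2)[symmetric] Qt by blast
  qed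
  have "\<forall>i. \<exists>a. i \<in> {1..t} \<longrightarrow> (\<forall>j\<in>block n i. a j \<in> fixed_field (Q (Suc i))) \<and>
      indep_over_fixed (\<lambda>x :: 'b. x ^ Q i) a (block n i)"
  proof
    fix i
    show "\<exists>a. i \<in> {1..t} \<longrightarrow> (\<forall>j\<in>block n i. a j \<in> fixed_field (Q (Suc i))) \<and>
      indep_over_fixed (\<lambda>x :: 'b. x ^ Q i) a (block n i)"
    proof (cases "i \<in> {1..t}")
      case True
      then have i: "1 \<le> i" "i \<le> Suc t" "Suc i \<le> Suc t" by auto
      have "card (fixed_field (Q i ^ m i) :: 'b set) = Q i ^ m i"
        using cardQ[of "Suc i"] i Q_Suc[OF i(1)] by simp
      moreover have "finite (block n i)" by (simp add: block_def)
      moreover have "card (block n i) \<le> m i" using card_block[OF i(1)] m[OF True] by simp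
      ultimately show ?thesis
        using independent_family_over_fixed_field[OF frob Q1[OF i(2)]] Q_Suc[OF i(1)] by metis
    next
      case False
      then show ?thesis by blast
    qed
  qed
  then obtain a where a: "\<And>i j. i \<in> {1..t} \<Longrightarrow> j \<in> block n i \<Longrightarrow> a i j \<in> fixed_field (Q (Suc i))"
    "\<And>i. i \<in> {1..t} \<Longrightarrow> indep_over_fixed (\<lambda>x :: 'b. x ^ Q i) (a i) (block n i)" by metis
  \<comment> \<open>The families chosen for the disjoint blocks are glued to a single one.\<close>
  define \<alpha> where "\<alpha> = (\<lambda>j. a (THE i. i \<ge> 1 \<and> j \<in> block n i) j)"
  have \<alpha>: "\<alpha> j = a i j" if "i \<ge> 1" "j \<in> block n i" for i j
  proof -
    have "(THE i. i \<ge> 1 \<and> j \<in> block n i) = i"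
      using that block_unique by (intro the_equality) blast+
    then show ?thesis by (simp add: \<alpha>_def)
  qed
  have \<alpha>_fixed: "\<alpha> j \<in> fixed_field (Q i)"
    if "1 \<le> i'" "i' < i" "i \<le> Suc t" "j \<in> block n i'" for i i' j
  proof -
    have "\<alpha> j \<in> fixed_field (Q (Suc i'))" using a(1)[of i' j] \<alpha>[of i' j] that by simp
    moreover have "\<exists>r>0. Q i = Q (Suc i') ^ r" using that by (intro Q_mono) auto
    ultimately show ?thesis using fixed_field_power by force
  qed
  let ?G = "block_moore_mat \<alpha> Q k n t"
  have G: "matrix_qm h ?G = direct_sums (\<lambda>i. uniform_qm (k i) (n i)) t"
  proof (rule matrix_qm_block_moore_mat[OF h t frob])
    show "h x ^ Q i = h x" for i x
      using field_hom_image_in_fixed_field[OF h, of x "e i"] by (simp add: fixed_field_def Q_def)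
    show "\<alpha> j ^ Q i = \<alpha> j" if "1 \<le> i'" "i' < i" "i \<le> t" "j \<in> block n i'" for i i' j
      using \<alpha>_fixed[of i' i j] that by (simp add: fixed_field_def)
    show "indep_over_fixed (\<lambda>x. x ^ Q i) \<alpha> (block n i)" if i: "i \<in> {1..t}" for i
      using a(2)[OF i] indep_over_fixed_cong[of "block n i" \<alpha> "a i"] \<alpha> i by simp
  qed
  have "elements_mat ?G \<subseteq> ?K"
  proof
    fix x assume "x \<in> elements_mat ?G"
    then obtain r j where r: "r < length (row_indices k t)" "j < (\<Sum>l\<in>{1..t}. n l)" "x = ?G $$ (r, j)"
      by (auto simp: elements_mat_def block_moore_mat_def)
    obtain i l where il: "row_indices k t ! r = (i, l)" by (cases "row_indices k t ! r")
    then have i: "i \<in> {1..t}" using r(1) set_row_indices[of k t] nth_mem by fastforce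
    have x: "x = (if j \<in> block n i then \<alpha> j ^ (Q i ^ l) else 0)"
      using r il by (simp add: block_moore_mat_def)
    show "x \<in> ?K"
    proof (cases "j \<in> block n i")
      case True
      then have "\<alpha> j \<in> fixed_field (Q (Suc t))" using \<alpha>_fixed[of i "Suc t" j] i by simp
      then show ?thesis using True x power_in_fixed_field Qt by metis
    next
      case False
      then show ?thesis using x Q1[of "Suc t"] by (simp add: fixed_field_def Qt)
    qed
  qed
  moreover have "dim_col ?G = ground_dim (direct_sums (\<lambda>i. uniform_qm (k i) (n i)) t :: 'a qmatroid)"
    using direct_sums_uniform(1)[OF t, where k = k and n = n and ?'a = 'a]
    by (simp add: block_moore_mat_def)
  moreover have "q_matroid (direct_sums (\<lambda>i. uniform_qm (k i) (n i)) t :: 'a qmatroid)"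
    using q_matroid_matrix_qm[OF h, of ?G] G by simp
  moreover have "int (vec_space.rank (dim_row ?G) ?G) =
      qm_rank (direct_sums (\<lambda>i. uniform_qm (k i) (n i)) t :: 'a qmatroid)"
    using rank_eq_qm_rank[OF h, of ?G] G by simp
  ultimately show ?thesis unfolding representable_over_def using G by metis
qed

lemma extension_in_alg_closure:
  assumes "d > 0"
  shows "extension_of_degree to_ac (fixed_field (CARD('a) ^ d) :: 'a::{finite,field} alg_closure set) d"
    and "card (fixed_field (CARD('a) ^ d) :: 'a alg_closure set) = CARD('a) ^ d"
proof -
  let ?K = "fixed_field (CARD('a) ^ d) :: 'a alg_closure set"
  have h: "field_hom (to_ac :: 'a \<Rightarrow> 'a alg_closure)" by unfold_locales simp_all
  have "card {0, 1 :: 'a} \<le> CARD('a)" by (intro card_mono) auto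
  then have q: "CARD('a) ^ d > 1" using assms by (intro one_less_power) simp_all
  obtain e where e: "CARD('a) = CHAR('a) ^ e"
    using card_finite_field_is_CHAR_power[where ?'a = 'a] by blast
  then have "CARD('a) ^ d = CHAR('a alg_closure) ^ (e * d)"
    by (simp add: power_mult CHAR_field_hom[OF h])
  moreover have "e * d > 0" using q e by (cases "e = 0") (simp_all add: assms)
  ultimately have "CHAR('a alg_closure) dvd CARD('a) ^ d" by (simp add: dvd_power)
  then have "of_nat (CARD('a) ^ d) = (0 :: 'a alg_closure)" using of_nat_eq_0_iff_char_dvd by blast
  then show c: "card ?K = CARD('a) ^ d" using card_fixed_field_alg_closed[OF q] by blast
  show "extension_of_degree to_ac ?K d"
    unfolding extension_of_degree_def
    using h subfield_fixed_field[OF frobenius_field_hom[OF h]] c field_hom_image_in_fixed_field[OF h]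
    by blast
qed

theorem theorem3p3:
  fixes t :: nat and k n :: "nat \<Rightarrow> nat"
  assumes "t > 0"
    and "\<forall>i\<in>{1..t}. 0 < k i \<and> k i < n i"
  shows "representable (direct_sums (\<lambda>i. uniform_qm (k i) (n i)) t :: 'a::{finite,field} qmatroid) \<and>
    (\<forall>m :: nat \<Rightarrow> nat. \<forall>(h :: 'a \<Rightarrow> 'b::field) K.
       (\<forall>i\<in>{1..t}. 0 < m i \<and> n i \<le> m i) \<longrightarrow>
       (\<forall>i\<in>{1..t}. \<forall>j\<in>{1..t}. i \<noteq> j \<longrightarrow> gcd (m i) (m j) = 1) \<longrightarrow>
       extension_of_degree h K (\<Prod>i\<in>{1..t}. m i) \<longrightarrow>
       representable_over h K (direct_sums (\<lambda>i. uniform_qm (k i) (n i)) t))"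
proof (intro conjI allI impI)
  let ?d = "\<Prod>i\<in>{1..t}. n i"
  have d: "?d > 0" using assms(2) by (intro prod_pos) fastforce
  note ext = extension_in_alg_closure[OF d, where ?'a = 'a]
  have "representable_over to_ac (fixed_field (CARD('a) ^ ?d))
      (direct_sums (\<lambda>i. uniform_qm (k i) (n i)) t :: 'a qmatroid)"
    using ext assms by (intro representable_over_tower) (fastforce simp: extension_of_degree_def)+
  then show "representable (direct_sums (\<lambda>i. uniform_qm (k i) (n i)) t :: 'a qmatroid)"
    unfolding representable_def using d ext(1) by blast
next
  fix m :: "nat \<Rightarrow> nat" and h :: "'a \<Rightarrow> 'b" and K
  let ?d = "\<Prod>i\<in>{1..t}. m i"
  assume m: "\<forall>i\<in>{1..t}. 0 < m i \<and> n i \<le> m i" and ext: "extension_of_degree h K ?d"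
  have "?d > 0" using m by (intro prod_pos) blast
  moreover have "card {0, 1 :: 'a} \<le> CARD('a)" by (intro card_mono) auto
  ultimately have "CARD('a) ^ ?d > 1" by (intro one_less_power) simp_all
  then have K: "K = fixed_field (CARD('a) ^ ?d)"
    using ext subfield_eq_fixed_field unfolding extension_of_degree_def by blast
  show "representable_over h K (direct_sums (\<lambda>i. uniform_qm (k i) (n i)) t)"
    unfolding K using assms(1) m ext K by (intro representable_over_tower) (auto simp: extension_of_degree_def)
qed

end
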